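(* Let $(A,\circ_A,[\cdot,\cdot]_A)$ be a Gel'fand-Dorfman algebra. Suppose that there is a Gel'fand-Dorfman algebra structure $(A^\ast,\circ_{A^\ast},[\cdot,\cdot]_{A^\ast})$ on $A^\ast$ and let $(A,\Delta,\delta)$ be the corresponding dual Gel'fand-Dorfman coalgebra. Then $$(A,A^\ast,L_{\star_A}^\ast,-R_{\circ_A}^\ast,\mathrm{ad}_A^\ast,L_{\star_{A^\ast}}^\ast,-R_{\circ_{A^\ast}}^\ast,\mathrm{ad}_{A^\ast}^\ast)$$ is a matched pair of Gel'fand-Dorfman algebras if and only if $(A,\circ_A,[\cdot,\cdot]_A,\Delta,\delta)$ is a Gel'fand-Dorfman bialgebra.
   Context: Conventions: $\mathbf{k}$ is a field of characteristic $0$; vector spaces over $\mathbf{k}$ are finite-dimensional (and $A^{\ast\ast}=A$); $\tau(a\otimes b)=b\otimes a$. $L_\circ(a)b=a\circ b$, $R_\circ(a)b=b\circ a$, $a\star b=a\circ b+b\circ a$, $L_\star(a)b=a\star b$, $\mathrm{ad}(a)b=[a,b]$, $a.(b\otimes c)=[a,b]\otimes c+b\otimes[a,c]$; subscripts $A$, $A^\ast$ indicate the algebra. For $\varphi:A\to\mathrm{End}_{\mathbf{k}}(V)$ linear, $\varphi^\ast:A\to\mathrm{End}_{\mathbf{k}}(V^\ast)$ is $\langle\varphi^\ast(a)f,u\rangle=-\langle f,\varphi(a)u\rangle$. A Novikov algebra $(A,\circ)$ satisfies $(a\circ b)\circ c-a\circ(b\circ c)=(b\circ a)\circ c-b\circ(a\circ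 c)$ and $(a\circ b)\circ c=(a\circ c)\circ b$. A Gel'fand-Dorfman (GD) algebra $(A,\circ,[\cdot,\cdot])$ is a Novikov algebra $(A,\circ)$ and a Lie algebra $(A,[\cdot,\cdot])$ with $[a\circ b,c]-[a\circ c,b]+[a,b]\circ c-[a,c]\circ b-a\circ[b,c]=0$ for all $a,b,c$. Matched pair: for GD algebras $A,B$ and linear maps $l_A,r_A,\rho_A:A\to\mathrm{End}_{\mathbf{k}}(B)$, $l_B,r_B,\rho_B:B\to\mathrm{End}_{\mathbf{k}}(A)$, the octuple $(A,B,l_A,r_A,\rho_A,l_B,r_B,\rho_B)$ is a matched pair of GD algebras if $A\oplus B$ is a GD algebra under $(a+x)\bullet(b+y)=(a\circ_A b+l_B(x)b+r_B(y)a)+(x\circ_B y+l_A(a)y+r_A(b)x)$, $[a+x,b+y]=([a,b]_A+\rho_B(x)b-\rho_B(y)a)+([x,y]_B+\rho_A(a)y-\rho_A(b)x)$, for $a,b\in A$, $x,y\in B$. Dual coalgebra: $\Delta,\delta:A\to A\otimes A$ are determined by $\langle f\otimes g,\Delta(a)\rangle=\langle f\circ_{A^\ast}g,a\rangle$ and $\langle f\otimes g,\delta(a)\rangle=\langle[f,g]_{A^\ast},a\rangle$. A Novikov coalgebra $(A,\Delta)$: $(\mathrm{id}\otimes\Delta)\Delta-(\tau\otimes\mathrm{id})(\mathrm{id}\otimes\Delta)\Delta=(\Delta\otimes\mathrm{id})\Delta-(\tau\otimes\mathrm{id})(\Delta\otimes\mathrm{id})\Delta$ and $(\tau\otimes\mathrm{id})(\mathrm{id}\otimes\Delta)\tau\Delta=(\Delta\otimes\mathrm{id})\Delta$.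 A Lie coalgebra $(A,\delta)$: $\delta=-\tau\delta$ and $(\mathrm{id}\otimes\delta)\delta-(\tau\otimes\mathrm{id})(\mathrm{id}\otimes\delta)\delta=(\delta\otimes\mathrm{id})\delta$. A GD coalgebra $(A,\Delta,\delta)$: both of these and $(\mathrm{id}\otimes\delta)\Delta-(\tau\otimes\mathrm{id})(\mathrm{id}\otimes\Delta)\delta+(\tau\otimes\mathrm{id})(\mathrm{id}\otimes\delta)\tau\Delta=(\Delta\otimes\mathrm{id})\delta+(\delta\otimes\mathrm{id})\Delta$ (equivalently, the dual operations make $A^\ast$ a GD algebra). A Novikov bialgebra $(A,\circ,\Delta)$: Novikov algebra and Novikov coalgebra with, for all $a,b$: $\Delta(a\circ b)=(R_\circ(b)\otimes\mathrm{id})\Delta(a)+(\mathrm{id}\otimes L_\star(a))(\Delta(b)+\tau\Delta(b))$; $(L_\star(a)\otimes\mathrm{id})\Delta(b)-(\mathrm{id}\otimes L_\star(a))\tau\Delta(b)=(L_\star(b)\otimes\mathrm{id})\Delta(a)-(\mathrm{id}\otimes L_\star(b))\tau\Delta(a)$; $(\mathrm{id}\otimes R_\circ(a)-R_\circ(a)\otimes\mathrm{id})(\Delta(b)+\tau\Delta(b))=(\mathrm{id}\otimes R_\circ(b)-R_\circ(b)\otimes\mathrm{id})(\Delta(a)+\tau\Delta(a))$. A Lie bialgebra $(A,[\cdot,\cdot],\delta)$: Lie algebra and Lie coalgebra with $\delta([a,b])=a.\delta(b)-b.\delta(a)$. A GD bialgebra $(A,\circ,[\cdot,\cdot],\Delta,\delta)$: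 $(A,\circ,[\cdot,\cdot])$ is a GD algebra, $(A,\Delta,\delta)$ a GD coalgebra, $(A,\circ,\Delta)$ a Novikov bialgebra, $(A,[\cdot,\cdot],\delta)$ a Lie bialgebra, and for all $a,b$ $$\delta(b\circ a)+\Delta([a,b])=(R_\circ(a)\otimes\mathrm{id})\delta(b)+(L_\circ(b)\otimes\mathrm{id})\delta(a)+(\mathrm{id}\otimes L_\star(b))\delta(a)+a.\Delta(b)-(\mathrm{id}\otimes\mathrm{ad}(b))(\Delta(a)+\tau\Delta(a)).$$ *)

theory Defs
  imports
    Complex_Main
    "HOL-Library.Function_Algebras"
    "HOL-Analysis.Product_Vector"
begin

text \<open>
  A vector space is given by a scaling \<open>s\<close> on an abelian group, and algebra structures live on a
  subspace \<open>V\<close> of it. The carrier is needed because the dual space is a subspace of a function type.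
\<close>

section \<open>Linear and bilinear maps on subspaces\<close>

definition linear_on ::
  "('k::field \<Rightarrow> 'u::ab_group_add \<Rightarrow> 'u) \<Rightarrow> 'u set \<Rightarrow>
   ('k \<Rightarrow> 'w::ab_group_add \<Rightarrow> 'w) \<Rightarrow> 'w set \<Rightarrow> ('u \<Rightarrow> 'w) \<Rightarrow> bool"
  where "linear_on s U t W F \<longleftrightarrow>
    (\<forall>x\<in>U. F x \<in> W) \<and>
    (\<forall>x\<in>U. \<forall>y\<in>U. F (x + y) = F x + F y) \<and>
    (\<forall>c. \<forall>x\<in>U. F (s c x) = t c (F x))"

definition bilinear_on ::
  "('k::field \<Rightarrow> 'u::ab_group_add \<Rightarrow> 'u) \<Rightarrow> 'u set \<Rightarrow>
   ('k \<Rightarrow> 'v::ab_group_add \<Rightarrow> 'v) \<Rightarrow> 'v set \<Rightarrow>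
   ('k \<Rightarrow> 'w::ab_group_add \<Rightarrow> 'w) \<Rightarrow> 'w set \<Rightarrow> ('u \<Rightarrow> 'v \<Rightarrow> 'w) \<Rightarrow> bool"
  where "bilinear_on s U t V r W F \<longleftrightarrow>
    (\<forall>x\<in>U. linear_on t V r W (\<lambda>y. F x y)) \<and>
    (\<forall>y\<in>V. linear_on s U r W (\<lambda>x. F x y))"

definition algebra_on ::
  "('k::field \<Rightarrow> 'v::ab_group_add \<Rightarrow> 'v) \<Rightarrow> 'v set \<Rightarrow> ('v \<Rightarrow> 'v \<Rightarrow> 'v) \<Rightarrow> bool"
  where "algebra_on s V m \<longleftrightarrow>
    vector_space s \<and> module.subspace s V \<and> bilinear_on s V s V s V m"

section \<open>Gel'fand-Dorfman algebras\<close>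

definition Novikov_algebra ::
  "('k::field \<Rightarrow> 'v::ab_group_add \<Rightarrow> 'v) \<Rightarrow> 'v set \<Rightarrow> ('v \<Rightarrow> 'v \<Rightarrow> 'v) \<Rightarrow> bool"
  where "Novikov_algebra s V m \<longleftrightarrow> algebra_on s V m \<and>
    (\<forall>a\<in>V. \<forall>b\<in>V. \<forall>c\<in>V. m (m a b) c - m a (m b c) = m (m b a) c - m b (m a c)) \<and>
    (\<forall>a\<in>V. \<forall>b\<in>V. \<forall>c\<in>V. m (m a b) c = m (m a c) b)"

definition Lie_algebra ::
  "('k::field \<Rightarrow> 'v::ab_group_add \<Rightarrow> 'v) \<Rightarrow> 'v set \<Rightarrow> ('v \<Rightarrow> 'v \<Rightarrow> 'v) \<Rightarrow> bool"
  where "Lie_algebra s V br \<longleftrightarrow> algebra_on s V br \<and>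
    (\<forall>a\<in>V. br a a = 0) \<and>
    (\<forall>a\<in>V. \<forall>b\<in>V. \<forall>c\<in>V. br a (br b c) + br b (br c a) + br c (br a b) = 0)"

definition GD_algebra ::
  "('k::field \<Rightarrow> 'v::ab_group_add \<Rightarrow> 'v) \<Rightarrow> 'v set \<Rightarrow>
   ('v \<Rightarrow> 'v \<Rightarrow> 'v) \<Rightarrow> ('v \<Rightarrow> 'v \<Rightarrow> 'v) \<Rightarrow> bool"
  where "GD_algebra s V m br \<longleftrightarrow> Novikov_algebra s V m \<and> Lie_algebra s V br \<and>
    (\<forall>a\<in>V. \<forall>b\<in>V. \<forall>c\<in>V.
       br (m a b) c - br (m a c) b + m (br a b) c - m (br a c) b - m a (br b c) = 0)"

text \<open>The left multiplication \<open>L(a)\<close> is the partial application \<open>m a\<close>, and \<open>ad(a)\<close> is \<open>br a\<close>.\<close>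

definition R_op :: "('v \<Rightarrow> 'v \<Rightarrow> 'v) \<Rightarrow> 'v \<Rightarrow> 'v \<Rightarrow> 'v"
  where "R_op m a b = m b a"

definition star :: "('v \<Rightarrow> 'v \<Rightarrow> 'v::plus) \<Rightarrow> 'v \<Rightarrow> 'v \<Rightarrow> 'v"
  where "star m a b = m a b + m b a"

section \<open>Matched pairs\<close>

definition matched_product ::
  "('a \<Rightarrow> 'a \<Rightarrow> 'a::ab_group_add) \<Rightarrow> ('b \<Rightarrow> 'b \<Rightarrow> 'b::ab_group_add) \<Rightarrow>
   ('a \<Rightarrow> 'b \<Rightarrow> 'b) \<Rightarrow> ('a \<Rightarrow> 'b \<Rightarrow> 'b) \<Rightarrow> ('b \<Rightarrow> 'a \<Rightarrow> 'a) \<Rightarrow> ('b \<Rightarrow> 'a \<Rightarrow> 'a) \<Rightarrow>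
   'a \<times> 'b \<Rightarrow> 'a \<times> 'b \<Rightarrow> 'a \<times> 'b"
  where "matched_product mA mB lA rA lB rB = (\<lambda>(a, x) (b, y).
    (mA a b + lB x b + rB y a, mB x y + lA a y + rA b x))"

definition matched_bracket ::
  "('a \<Rightarrow> 'a \<Rightarrow> 'a::ab_group_add) \<Rightarrow> ('b \<Rightarrow> 'b \<Rightarrow> 'b::ab_group_add) \<Rightarrow>
   ('a \<Rightarrow> 'b \<Rightarrow> 'b) \<Rightarrow> ('b \<Rightarrow> 'a \<Rightarrow> 'a) \<Rightarrow> 'a \<times> 'b \<Rightarrow> 'a \<times> 'b \<Rightarrow> 'a \<times> 'b"
  where "matched_bracket brA brB \<rho>A \<rho>B = (\<lambda>(a, x) (b, y).
    (brA a b + \<rho>B x b - \<rho>B y a, brB x y + \<rho>A a y - \<rho>A b x))"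

definition matched_pair_GD ::
  "('k::field \<Rightarrow> 'a::ab_group_add \<Rightarrow> 'a) \<Rightarrow> 'a set \<Rightarrow> ('a \<Rightarrow> 'a \<Rightarrow> 'a) \<Rightarrow> ('a \<Rightarrow> 'a \<Rightarrow> 'a) \<Rightarrow>
   ('k \<Rightarrow> 'b::ab_group_add \<Rightarrow> 'b) \<Rightarrow> 'b set \<Rightarrow> ('b \<Rightarrow> 'b \<Rightarrow> 'b) \<Rightarrow> ('b \<Rightarrow> 'b \<Rightarrow> 'b) \<Rightarrow>
   ('a \<Rightarrow> 'b \<Rightarrow> 'b) \<Rightarrow> ('a \<Rightarrow> 'b \<Rightarrow> 'b) \<Rightarrow> ('a \<Rightarrow> 'b \<Rightarrow> 'b) \<Rightarrow>
   ('b \<Rightarrow> 'a \<Rightarrow> 'a) \<Rightarrow> ('b \<Rightarrow> 'a \<Rightarrow> 'a) \<Rightarrow> ('b \<Rightarrow> 'a \<Rightarrow> 'a) \<Rightarrow> bool"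
  where "matched_pair_GD sA A mA brA sB B mB brB lA rA \<rho>A lB rB \<rho>B \<longleftrightarrow>
    GD_algebra sA A mA brA \<and> GD_algebra sB B mB brB \<and>
    (\<forall>\<phi>\<in>{lA, rA, \<rho>A}. bilinear_on sA A sB B sB B \<phi>) \<and>
    (\<forall>\<phi>\<in>{lB, rB, \<rho>B}. bilinear_on sB B sA A sA A \<phi>) \<and>
    GD_algebra (module_prod.scale sA sB) (A \<times> B)
      (matched_product mA mB lA rA lB rB) (matched_bracket brA brB \<rho>A \<rho>B)"

section \<open>Dual spaces and dual representations\<close>

definition dual_space :: "('k::field \<Rightarrow> 'a::ab_group_add \<Rightarrow> 'a) \<Rightarrow> ('a \<Rightarrow> 'k) set"
  where "dual_space s = {f. Vector_Spaces.linear s (*) f}"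

definition fun_scale :: "'k::field \<Rightarrow> ('a \<Rightarrow> 'k) \<Rightarrow> 'a \<Rightarrow> 'k"
  where "fun_scale c f = (\<lambda>x. c * f x)"

definition dual_rep :: "('v \<Rightarrow> 'w \<Rightarrow> 'w) \<Rightarrow> 'v \<Rightarrow> ('w \<Rightarrow> 'k::field) \<Rightarrow> 'w \<Rightarrow> 'k"
  where "dual_rep \<phi> v f = (\<lambda>u. - f (\<phi> v u))"

text \<open>
  For a map \<open>\<phi>\<close> into the endomorphisms of the dual of \<open>A\<close>, the endomorphisms \<open>\<phi>\<^sup>*(v)\<close> of the bidual
  are transported to \<open>A\<close> along the identification of \<open>a\<close> with the evaluation \<open>\<lambda>h. h a\<close>. The
  description is proper for finite-dimensional \<open>A\<close>: see \<open>bidual_rep_pairing\<close>.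
\<close>

definition bidual_rep ::
  "('k::field \<Rightarrow> 'a::ab_group_add \<Rightarrow> 'a) \<Rightarrow> ('v \<Rightarrow> ('a \<Rightarrow> 'k) \<Rightarrow> ('a \<Rightarrow> 'k)) \<Rightarrow> 'v \<Rightarrow> 'a \<Rightarrow> 'a"
  where "bidual_rep s \<phi> v a =
    (THE b. \<forall>g\<in>dual_space s. g b = dual_rep \<phi> v (\<lambda>h. h a) g)"

section \<open>Tensor powers\<close>

text \<open>
  For finite-dimensional \<open>A\<close>, the tensor square and cube of \<open>A\<close> are realised as the bilinear and
  trilinear forms on the dual of \<open>A\<close>, where \<open>a \<otimes> b\<close> is the form sending \<open>(f, g)\<close> to \<open>f a * g b\<close>.
  Thus the pairing of \<open>f \<otimes> g\<close> with a tensor \<open>t\<close> is the value \<open>t f g\<close>. Arguments range over a full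
  function type, so forms are normalised to vanish off the dual space; equality of tensors is then
  equality of functions, and addition is pointwise.

  The lemmas below confirm that this is the tensor product: simple tensors span
  (\<open>tensor_sq_expand\<close>), bilinear maps factor uniquely (\<open>tensor_sq_universal\<close>), and the induced maps
  take the expected values on simple tensors.
\<close>

type_synonym ('a, 'k) tensor2 = "('a \<Rightarrow> 'k) \<Rightarrow> ('a \<Rightarrow> 'k) \<Rightarrow> 'k"
type_synonym ('a, 'k) tensor3 = "('a \<Rightarrow> 'k) \<Rightarrow> ('a \<Rightarrow> 'k) \<Rightarrow> ('a \<Rightarrow> 'k) \<Rightarrow> 'k"

definition form2 ::
  "('k::field \<Rightarrow> 'a::ab_group_add \<Rightarrow> 'a) \<Rightarrow> ('a, 'k) tensor2 \<Rightarrow> ('a, 'k) tensor2"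
  where "form2 s t = (\<lambda>f g. if f \<in> dual_space s \<and> g \<in> dual_space s then t f g else 0)"

definition form3 ::
  "('k::field \<Rightarrow> 'a::ab_group_add \<Rightarrow> 'a) \<Rightarrow> ('a, 'k) tensor3 \<Rightarrow> ('a, 'k) tensor3"
  where "form3 s t = (\<lambda>f g h. if f \<in> dual_space s \<and> g \<in> dual_space s \<and> h \<in> dual_space s
    then t f g h else 0)"

definition tensor_sq :: "('k::field \<Rightarrow> 'a::ab_group_add \<Rightarrow> 'a) \<Rightarrow> ('a, 'k) tensor2 set"
  where "tensor_sq s = {t. form2 s t = t \<and>
    bilinear_on fun_scale (dual_space s) fun_scale (dual_space s) (*) UNIV t}"

definition tensor_scale :: "'k::field \<Rightarrow> ('a, 'k) tensor2 \<Rightarrow> ('a, 'k) tensor2"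
  where "tensor_scale c t = (\<lambda>f g. c * t f g)"

definition tens2 :: "('k::field \<Rightarrow> 'a::ab_group_add \<Rightarrow> 'a) \<Rightarrow> 'a \<Rightarrow> 'a \<Rightarrow> ('a, 'k) tensor2"
  where "tens2 s a b = form2 s (\<lambda>f g. f a * g b)"

definition tens3 :: "('k::field \<Rightarrow> 'a::ab_group_add \<Rightarrow> 'a) \<Rightarrow> 'a \<Rightarrow> 'a \<Rightarrow> 'a \<Rightarrow> ('a, 'k) tensor3"
  where "tens3 s a b c = form3 s (\<lambda>f g h. f a * g b * h c)"

text \<open>\<open>F \<otimes> G\<close> for endomorphisms \<open>F\<close> and \<open>G\<close> of \<open>A\<close>\<close>

definition tmap ::
  "('k::field \<Rightarrow> 'a::ab_group_add \<Rightarrow> 'a) \<Rightarrow> ('a \<Rightarrow> 'a) \<Rightarrow> ('a \<Rightarrow> 'a) \<Rightarrow>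
   ('a, 'k) tensor2 \<Rightarrow> ('a, 'k) tensor2"
  where "tmap s F G t = form2 s (\<lambda>f g. t (f \<circ> F) (g \<circ> G))"

text \<open>\<open>\<tau>\<close> and \<open>\<tau> \<otimes> id\<close>\<close>

definition tflip :: "('a, 'k) tensor2 \<Rightarrow> ('a, 'k) tensor2"
  where "tflip t = (\<lambda>f g. t g f)"

definition tflip_id :: "('a, 'k) tensor3 \<Rightarrow> ('a, 'k) tensor3"
  where "tflip_id t = (\<lambda>f g h. t g f h)"

text \<open>\<open>id \<otimes> D\<close> and \<open>D \<otimes> id\<close> for a linear map \<open>D\<close> from \<open>A\<close> to its tensor square\<close>

definition id_tmap ::
  "('k::field \<Rightarrow> 'a::ab_group_add \<Rightarrow> 'a) \<Rightarrow> ('a \<Rightarrow> ('a, 'k) tensor2) \<Rightarrow>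
   ('a, 'k) tensor2 \<Rightarrow> ('a, 'k) tensor3"
  where "id_tmap s D t = form3 s (\<lambda>f g h. t f (\<lambda>a. D a g h))"

definition tmap_id ::
  "('k::field \<Rightarrow> 'a::ab_group_add \<Rightarrow> 'a) \<Rightarrow> ('a \<Rightarrow> ('a, 'k) tensor2) \<Rightarrow>
   ('a, 'k) tensor2 \<Rightarrow> ('a, 'k) tensor3"
  where "tmap_id s D t = form3 s (\<lambda>f g h. t (\<lambda>a. D a f g) h)"

section \<open>Gel'fand-Dorfman coalgebras and bialgebras\<close>

definition coalgebra ::
  "('k::field \<Rightarrow> 'a::ab_group_add \<Rightarrow> 'a) \<Rightarrow> ('a \<Rightarrow> ('a, 'k) tensor2) \<Rightarrow> bool"
  where "coalgebra s \<Delta> \<longleftrightarrow> vector_space s \<and> linear_on s UNIV tensor_scale (tensor_sq s) \<Delta>"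

definition Novikov_coalgebra ::
  "('k::field \<Rightarrow> 'a::ab_group_add \<Rightarrow> 'a) \<Rightarrow> ('a \<Rightarrow> ('a, 'k) tensor2) \<Rightarrow> bool"
  where "Novikov_coalgebra s \<Delta> \<longleftrightarrow> coalgebra s \<Delta> \<and>
    (\<forall>a. id_tmap s \<Delta> (\<Delta> a) - tflip_id (id_tmap s \<Delta> (\<Delta> a)) =
         tmap_id s \<Delta> (\<Delta> a) - tflip_id (tmap_id s \<Delta> (\<Delta> a))) \<and>
    (\<forall>a. tflip_id (id_tmap s \<Delta> (tflip (\<Delta> a))) = tmap_id s \<Delta> (\<Delta> a))"

definition Lie_coalgebra ::
  "('k::field \<Rightarrow> 'a::ab_group_add \<Rightarrow> 'a) \<Rightarrow> ('a \<Rightarrow> ('a, 'k) tensor2) \<Rightarrow> bool"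
  where "Lie_coalgebra s \<delta> \<longleftrightarrow> coalgebra s \<delta> \<and>
    (\<forall>a. \<delta> a = - tflip (\<delta> a)) \<and>
    (\<forall>a. id_tmap s \<delta> (\<delta> a) - tflip_id (id_tmap s \<delta> (\<delta> a)) = tmap_id s \<delta> (\<delta> a))"

definition GD_coalgebra ::
  "('k::field \<Rightarrow> 'a::ab_group_add \<Rightarrow> 'a) \<Rightarrow>
   ('a \<Rightarrow> ('a, 'k) tensor2) \<Rightarrow> ('a \<Rightarrow> ('a, 'k) tensor2) \<Rightarrow> bool"
  where "GD_coalgebra s \<Delta> \<delta> \<longleftrightarrow> Novikov_coalgebra s \<Delta> \<and> Lie_coalgebra s \<delta> \<and>
    (\<forall>a. id_tmap s \<delta> (\<Delta> a) - tflip_id (id_tmap s \<Delta> (\<delta> a)) + tflip_id (id_tmap s \<delta> (tflip (\<Delta> a))) =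
         tmap_id s \<Delta> (\<delta> a) + tmap_id s \<delta> (\<Delta> a))"

definition Novikov_bialgebra ::
  "('k::field \<Rightarrow> 'a::ab_group_add \<Rightarrow> 'a) \<Rightarrow> ('a \<Rightarrow> 'a \<Rightarrow> 'a) \<Rightarrow>
   ('a \<Rightarrow> ('a, 'k) tensor2) \<Rightarrow> bool"
  where "Novikov_bialgebra s m \<Delta> \<longleftrightarrow> Novikov_algebra s UNIV m \<and> Novikov_coalgebra s \<Delta> \<and>
    (\<forall>a b. \<Delta> (m a b) =
       tmap s (R_op m b) id (\<Delta> a) + tmap s id (star m a) (\<Delta> b + tflip (\<Delta> b))) \<and>
    (\<forall>a b. tmap s (star m a) id (\<Delta> b) - tmap s id (star m a) (tflip (\<Delta> b)) =
           tmap s (star m b) id (\<Delta> a) - tmap s id (star m b) (tflip (\<Delta> a))) \<and>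
    (\<forall>a b. tmap s id (R_op m a) (\<Delta> b + tflip (\<Delta> b)) - tmap s (R_op m a) id (\<Delta> b + tflip (\<Delta> b)) =
           tmap s id (R_op m b) (\<Delta> a + tflip (\<Delta> a)) - tmap s (R_op m b) id (\<Delta> a + tflip (\<Delta> a)))"

text \<open>\<open>a.t\<close>, extending \<open>a.(b \<otimes> c) = [a,b] \<otimes> c + b \<otimes> [a,c]\<close>\<close>

definition tensor_act ::
  "('k::field \<Rightarrow> 'a::ab_group_add \<Rightarrow> 'a) \<Rightarrow> ('a \<Rightarrow> 'a \<Rightarrow> 'a) \<Rightarrow> 'a \<Rightarrow>
   ('a, 'k) tensor2 \<Rightarrow> ('a, 'k) tensor2"
  where "tensor_act s br a t = tmap s (br a) id t + tmap s id (br a) t"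

definition Lie_bialgebra ::
  "('k::field \<Rightarrow> 'a::ab_group_add \<Rightarrow> 'a) \<Rightarrow> ('a \<Rightarrow> 'a \<Rightarrow> 'a) \<Rightarrow>
   ('a \<Rightarrow> ('a, 'k) tensor2) \<Rightarrow> bool"
  where "Lie_bialgebra s br \<delta> \<longleftrightarrow> Lie_algebra s UNIV br \<and> Lie_coalgebra s \<delta> \<and>
    (\<forall>a b. \<delta> (br a b) = tensor_act s br a (\<delta> b) - tensor_act s br b (\<delta> a))"

definition GD_bialgebra ::
  "('k::field \<Rightarrow> 'a::ab_group_add \<Rightarrow> 'a) \<Rightarrow> ('a \<Rightarrow> 'a \<Rightarrow> 'a) \<Rightarrow> ('a \<Rightarrow> 'a \<Rightarrow> 'a) \<Rightarrow>
   ('a \<Rightarrow> ('a, 'k) tensor2) \<Rightarrow> ('a \<Rightarrow> ('a, 'k) tensor2) \<Rightarrow> bool"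
  where "GD_bialgebra s m br \<Delta> \<delta> \<longleftrightarrow>
    GD_algebra s UNIV m br \<and> GD_coalgebra s \<Delta> \<delta> \<and>
    Novikov_bialgebra s m \<Delta> \<and> Lie_bialgebra s br \<delta> \<and>
    (\<forall>a b. \<delta> (m b a) + \<Delta> (br a b) =
       tmap s (R_op m a) id (\<delta> b) + tmap s (m b) id (\<delta> a) + tmap s id (star m b) (\<delta> a)
       + tensor_act s br a (\<Delta> b) - tmap s id (br b) (\<Delta> a + tflip (\<Delta> a)))"

text \<open>The comultiplication on \<open>A\<close> dual to a product on the dual of \<open>A\<close>\<close>

definition dual_comult ::
  "('k::field \<Rightarrow> 'a::ab_group_add \<Rightarrow> 'a) \<Rightarrow> (('a \<Rightarrow> 'k) \<Rightarrow> ('a \<Rightarrow> 'k) \<Rightarrow> ('a \<Rightarrow> 'k)) \<Rightarrow>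
   'a \<Rightarrow> ('a, 'k) tensor2"
  where "dual_comult s M a = form2 s (\<lambda>f g. M f g a)"

section \<open>Adequacy of the encoding\<close>

lemma dual_space_linear_on:
  fixes s :: "'k::field \<Rightarrow> 'a::ab_group_add \<Rightarrow> 'a"
  shows "vector_space s \<Longrightarrow> f \<in> dual_space s \<longleftrightarrow> linear_on s UNIV (*) UNIV f"
proof -
  have "vector_space ((*) :: 'k::field \<Rightarrow> 'k \<Rightarrow> 'k)"
    by (auto intro: vector_space.intro simp: algebra_simps)
  then show "f \<in> dual_space s \<longleftrightarrow> linear_on s UNIV (*) UNIV f" if "vector_space s"
    using that
    by (auto simp: dual_space_def linear_on_def Vector_Spaces.linear_iff)
qed

lemma dual_space_add:
  assumes "vector_space s" "f \<in> dual_space s" shows "f (x + y) = f x + f y"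
  using assms by (simp add: dual_space_linear_on linear_on_def)

lemma dual_space_scale:
  assumes "vector_space s" "f \<in> dual_space s" shows "f (s c x) = c * f x"
  using assms by (simp add: dual_space_linear_on linear_on_def)

lemma dual_space_plus:
  assumes "vector_space s" "f \<in> dual_space s" "g \<in> dual_space s" shows "f + g \<in> dual_space s"
  using assms by (simp add: dual_space_linear_on linear_on_def algebra_simps)

lemma dual_space_fun_scale:
  assumes "vector_space s" "f \<in> dual_space s" shows "fun_scale c f \<in> dual_space s"
  using assms by (simp add: dual_space_linear_on linear_on_def fun_scale_def algebra_simps)

lemma vector_space_fun_scale: "vector_space (fun_scale :: 'k::field \<Rightarrow> ('a \<Rightarrow> 'k) \<Rightarrow> 'a \<Rightarrow> 'k)"
  by unfold_locales (auto simp: fun_scale_def fun_eq_iff algebra_simps)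

lemma dual_space_compose:
  assumes "vector_space s" "f \<in> dual_space s" "linear_on s UNIV s UNIV F"
  shows "f \<circ> F \<in> dual_space s"
  using assms by (simp add: dual_space_linear_on linear_on_def)

context finite_dimensional_vector_space
begin

definition cofun :: "'b \<Rightarrow> 'b \<Rightarrow> 'a"
  where "cofun e v = representation Basis v e"

lemma cofun_dual: "cofun e \<in> dual_space scale"
  unfolding dual_space_linear_on[OF vector_space_axioms]
  by (simp add: linear_on_def cofun_def representation_add representation_scale
      independent_Basis span_Basis)

lemma expand_Basis: "v = (\<Sum>e\<in>Basis. cofun e v *s e)"
  unfolding cofun_def
  by (rule sum_representation_eq[symmetric])
    (auto simp: independent_Basis span_Basis finite_Basis)

lemma dual_sum:
  assumes "f \<in> dual_space scale" shows "f (\<Sum>e\<in>I. c e *s e) = (\<Sum>e\<in>I. c e * f e)"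
proof (cases "finite I")
  case True
  have "f 0 = 0"
    using dual_space_scale[OF vector_space_axioms assms, of 0 0] by simp
  with True show ?thesis
    by (induction I rule: finite_induct)
      (simp_all add: dual_space_add[OF vector_space_axioms assms]
        dual_space_scale[OF vector_space_axioms assms])
next
  case False
  then show ?thesis
    using dual_space_scale[OF vector_space_axioms assms, of 0 0] by simp
qed

lemma dual_expand:
  assumes "f \<in> dual_space scale" shows "f v = (\<Sum>e\<in>Basis. f e * cofun e v)"
  using dual_sum[OF assms, of "\<lambda>e. cofun e v" Basis] expand_Basis[of v]
  by (simp add: mult.commute)

lemma dual_separates: "(\<forall>g\<in>dual_space scale. g a = g b) \<Longrightarrow> a = b"
  using cofun_dual expand_Basis by (metis (no_types, lifting) sum.cong)

lemma bidual_eval: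
  assumes "linear_on fun_scale (dual_space scale) (*) UNIV \<Phi>"
  shows "\<exists>!b. \<forall>g\<in>dual_space scale. g b = \<Phi> g"
proof (rule ex_ex1I)
  have sum: "\<Phi> (\<Sum>e\<in>I. fun_scale (c e) (cofun e)) = (\<Sum>e\<in>I. c e * \<Phi> (cofun e)) \<and>
      (\<Sum>e\<in>I. fun_scale (c e) (cofun e)) \<in> dual_space scale" if "finite I" for I and c :: "'b \<Rightarrow> 'a"
    using that
  proof (induction I rule: finite_induct)
    case empty
    have z: "fun_scale 0 (cofun undefined) = (0 :: 'b \<Rightarrow> 'a)"
      by (simp add: fun_scale_def fun_eq_iff)
    have "\<Phi> (fun_scale 0 (cofun undefined)) = 0 * \<Phi> (cofun undefined)"
      using assms cofun_dual by (simp add: linear_on_def)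
    moreover have "fun_scale 0 (cofun undefined) \<in> dual_space scale"
      by (rule dual_space_fun_scale[OF vector_space_axioms cofun_dual])
    ultimately show ?case
      unfolding z by (simp only: sum.empty mult_zero_left simp_thms)
  next
    case (insert e I)
    let ?S = "\<Sum>e\<in>I. fun_scale (c e) (cofun e)"
    have e: "fun_scale (c e) (cofun e) \<in> dual_space scale"
      by (rule dual_space_fun_scale[OF vector_space_axioms cofun_dual])
    have "\<Phi> (fun_scale (c e) (cofun e) + ?S) = \<Phi> (fun_scale (c e) (cofun e)) + \<Phi> ?S"
      using assms insert.IH e by (simp only: linear_on_def)
    moreover have "\<Phi> (fun_scale (c e) (cofun e)) = c e * \<Phi> (cofun e)"
      using assms cofun_dual by (simp only: linear_on_def)
    ultimately show ?case
      using insert.hyps insert.IH dual_space_plus[OF vector_space_axioms e, of ?S]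
      by (simp only: sum.insert simp_thms)
  qed
  define b where "b = (\<Sum>e\<in>Basis. \<Phi> (cofun e) *s e)"
  have "g b = \<Phi> g" if g: "g \<in> dual_space scale" for g
  proof -
    have "g = (\<Sum>e\<in>Basis. fun_scale (g e) (cofun e))"
    proof
      fix v
      have "(\<Sum>e\<in>I. fun_scale (g e) (cofun e)) v = (\<Sum>e\<in>I. g e * cofun e v)" if "finite I" for I
        using that by (induction I rule: finite_induct) (simp_all add: fun_scale_def)
      then show "g v = (\<Sum>e\<in>Basis. fun_scale (g e) (cofun e)) v"
        using dual_expand[OF g, of v] finite_Basis by simp
    qed
    then have "\<Phi> g = (\<Sum>e\<in>Basis. g e * \<Phi> (cofun e))"
      using sum[OF finite_Basis, of g] by metis
    then show ?thesis
      by (simp add: b_def dual_sum[OF g] mult.commute)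
  qed
  then show "\<exists>b. \<forall>g\<in>dual_space scale. g b = \<Phi> g"
    by blast
next
  fix b b'
  assume "\<forall>g\<in>dual_space scale. g b = \<Phi> g" "\<forall>g\<in>dual_space scale. g b' = \<Phi> g"
  then show "b = b'"
    by (intro dual_separates) simp
qed

lemma bidual_rep_pairing:
  assumes "linear_on fun_scale (dual_space scale) fun_scale (dual_space scale) (\<phi> v)"
    and "g \<in> dual_space scale"
  shows "g (bidual_rep scale \<phi> v a) = - \<phi> v g a"
proof -
  have "linear_on fun_scale (dual_space scale) (*) UNIV (\<lambda>g. dual_rep \<phi> v (\<lambda>h. h a) g)"
    using assms(1) by (simp add: linear_on_def dual_rep_def fun_scale_def)
  from theI'[OF bidual_eval[OF this]] assms(2) show ?thesis
    by (simp add: bidual_rep_def dual_rep_def)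
qed

lemma tens2_apply:
  "f \<in> dual_space scale \<Longrightarrow> g \<in> dual_space scale \<Longrightarrow> tens2 scale a b f g = f a * g b"
  by (simp add: tens2_def form2_def)

lemma tensor_sq_iff:
  "t \<in> tensor_sq scale \<longleftrightarrow>
    bilinear_on fun_scale (dual_space scale) fun_scale (dual_space scale) (*) UNIV t \<and>
    (\<forall>f g. \<not> (f \<in> dual_space scale \<and> g \<in> dual_space scale) \<longrightarrow> t f g = 0)"
  unfolding tensor_sq_def form2_def fun_eq_iff by (auto split: if_splits)

lemma tens2_in: "tens2 scale a b \<in> tensor_sq scale"
  using dual_space_plus[OF vector_space_axioms] dual_space_fun_scale[OF vector_space_axioms]
  by (simp add: tensor_sq_iff tens2_def form2_def bilinear_on_def linear_on_def algebra_simps)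
    (simp add: fun_scale_def)

lemma tens2_bilinear: "bilinear_on scale UNIV scale UNIV tensor_scale (tensor_sq scale) (tens2 scale)"
  using tens2_in
  by (auto simp: bilinear_on_def linear_on_def tens2_def form2_def tensor_scale_def fun_eq_iff
      dual_space_add[OF vector_space_axioms] dual_space_scale[OF vector_space_axioms] algebra_simps)

lemma sum_fun_apply: "(\<Sum>i\<in>I. F i) x = (\<Sum>i\<in>I. F i x)"
  for F :: "'i \<Rightarrow> 'x \<Rightarrow> 'y::ab_group_add"
  by (induction I rule: infinite_finite_induct) simp_all

lemma tensor_sq_fixed_arg:
  assumes "t \<in> tensor_sq scale" "f \<in> dual_space scale"
  shows "linear_on fun_scale (dual_space scale) (*) UNIV (t f)"
    and "linear_on fun_scale (dual_space scale) (*) UNIV (\<lambda>g. t g f)"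
  using assms by (simp_all add: tensor_sq_def bilinear_on_def)

lemma linear_on_dual_expand:
  assumes "linear_on fun_scale (dual_space scale) (*) UNIV \<Phi>" "g \<in> dual_space scale"
  shows "\<Phi> g = (\<Sum>e\<in>Basis. g e * \<Phi> (cofun e))"
proof -
  obtain b where b: "\<forall>g\<in>dual_space scale. g b = \<Phi> g"
    using bidual_eval[OF assms(1)] by blast
  then have "\<Phi> g = g b"
    using assms(2) by simp
  also have "\<dots> = (\<Sum>e\<in>Basis. g e * cofun e b)"
    by (rule dual_expand[OF assms(2)])
  also have "\<dots> = (\<Sum>e\<in>Basis. g e * \<Phi> (cofun e))"
    using b cofun_dual by simp
  finally show ?thesis .
qed

lemma tensor_sq_expand:
  assumes "t \<in> tensor_sq scale"
  shows "t = (\<Sum>i\<in>Basis. \<Sum>j\<in>Basis. tensor_scale (t (cofun i) (cofun j)) (tens2 scale i j))"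
proof (intro ext)
  fix f g
  show "t f g = (\<Sum>i\<in>Basis. \<Sum>j\<in>Basis.
      tensor_scale (t (cofun i) (cofun j)) (tens2 scale i j)) f g"
  proof (cases "f \<in> dual_space scale \<and> g \<in> dual_space scale")
    case True
    have "t f g = (\<Sum>i\<in>Basis. f i * t (cofun i) g)"
      using linear_on_dual_expand[OF tensor_sq_fixed_arg(2)[OF assms]] True by blast
    also have "\<dots> = (\<Sum>i\<in>Basis. f i * (\<Sum>j\<in>Basis. g j * t (cofun i) (cofun j)))"
      using linear_on_dual_expand[OF tensor_sq_fixed_arg(1)[OF assms cofun_dual]] True by simp
    finally show ?thesis
      using True by (simp add: sum_fun_apply tensor_scale_def tens2_apply sum_distrib_left
          mult_ac)
  next
    case False
    have "t f g = form2 scale t f g"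
      using assms by (simp add: tensor_sq_def)
    then show ?thesis
      using False by (auto simp: sum_fun_apply tensor_scale_def tens2_def form2_def)
  qed
qed

lemma tensor_sq_plus: "t \<in> tensor_sq scale \<Longrightarrow> u \<in> tensor_sq scale \<Longrightarrow> t + u \<in> tensor_sq scale"
  unfolding tensor_sq_iff bilinear_on_def linear_on_def by (simp add: algebra_simps)

lemma tensor_sq_scale: "t \<in> tensor_sq scale \<Longrightarrow> tensor_scale c t \<in> tensor_sq scale"
  unfolding tensor_sq_iff bilinear_on_def linear_on_def tensor_scale_def by (simp add: algebra_simps)

lemma linear_on_tensor_sum:
  assumes "vector_space r" "linear_on tensor_scale (tensor_sq scale) r UNIV L"
    and "\<And>i. i \<in> I \<Longrightarrow> u i \<in> tensor_sq scale"
  shows "L (\<Sum>i\<in>I. u i) = (\<Sum>i\<in>I. L (u i)) \<and> (\<Sum>i\<in>I. u i) \<in> tensor_sq scale"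
proof -
  interpret r: vector_space r by fact
  have z: "tensor_scale 0 (tens2 scale 0 0) = 0"
    by (simp add: tensor_scale_def fun_eq_iff)
  have "L (tensor_scale 0 (tens2 scale 0 0)) = r 0 (L (tens2 scale 0 0))"
    using assms(2) tens2_in[of 0 0] by (simp only: linear_on_def)
  then have zero: "L 0 = 0" "0 \<in> tensor_sq scale"
    using tensor_sq_scale[OF tens2_in, of 0 0 0] by (simp_all only: z r.scale_zero_left)
  show ?thesis
    using assms(3)
  proof (induction I rule: infinite_finite_induct)
    case (insert i I)
    then have IH: "L (\<Sum>i\<in>I. u i) = (\<Sum>i\<in>I. L (u i))" "(\<Sum>i\<in>I. u i) \<in> tensor_sq scale"
      and ui: "u i \<in> tensor_sq scale"
      by blast+
    moreover have "L (u i + (\<Sum>i\<in>I. u i)) = L (u i) + L (\<Sum>i\<in>I. u i)"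
      using assms(2) IH ui by (simp only: linear_on_def)
    ultimately show ?case
      using insert.hyps tensor_sq_plus[OF ui IH(2)] by (simp only: sum.insert simp_thms)
  qed (use zero in \<open>simp_all only: sum.infinite sum.empty simp_thms not_False_eq_True\<close>)
qed

lemma tensor_sq_universal:
  assumes "vector_space r" "bilinear_on scale UNIV scale UNIV r UNIV \<beta>"
  shows "\<exists>L. linear_on tensor_scale (tensor_sq scale) r UNIV L \<and> (\<forall>a b. L (tens2 scale a b) = \<beta> a b)"
    and "linear_on tensor_scale (tensor_sq scale) r UNIV L \<Longrightarrow>
         linear_on tensor_scale (tensor_sq scale) r UNIV L' \<Longrightarrow>
         \<forall>a b. L (tens2 scale a b) = L' (tens2 scale a b) \<Longrightarrow> t \<in> tensor_sq scale \<Longrightarrow> L t = L' t"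
proof -
  interpret r: vector_space r by fact
  define L where "L t = (\<Sum>i\<in>Basis. \<Sum>j\<in>Basis. r (t (cofun i) (cofun j)) (\<beta> i j))" for t
  have lin: "linear_on tensor_scale (tensor_sq scale) r UNIV L"
    by (auto simp: linear_on_def L_def tensor_scale_def r.scale_left_distrib sum.distrib
        r.scale_sum_right)
  have beta: "linear_on scale UNIV r UNIV (\<beta> a)" "linear_on scale UNIV r UNIV (\<lambda>a. \<beta> a b)" for a b
    using assms(2) by (simp_all add: bilinear_on_def)
  have lin_sum: "F v = (\<Sum>e\<in>Basis. r (cofun e v) (F e))" if F: "linear_on scale UNIV r UNIV F" for F v
  proof -
    have "F 0 = 0"
      using F unfolding linear_on_def by (metis UNIV_I r.scale_zero_left scale_zero_left)
    then have "F (\<Sum>e\<in>I. c e *s e) = (\<Sum>e\<in>I. r (c e) (F e))" for I c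
      by (induction I rule: infinite_finite_induct) (use F in \<open>simp_all add: linear_on_def\<close>)
    then show ?thesis
      using expand_Basis[of v] by metis
  qed
  have "L (tens2 scale a b) = \<beta> a b" for a b
  proof -
    have "\<beta> a b = (\<Sum>i\<in>Basis. r (cofun i a) (\<beta> i b))"
      by (rule lin_sum[OF beta(2)])
    also have "\<dots> = (\<Sum>i\<in>Basis. r (cofun i a) (\<Sum>j\<in>Basis. r (cofun j b) (\<beta> i j)))"
      using lin_sum[OF beta(1)] by (metis (no_types, lifting) sum.cong)
    also have "\<dots> = L (tens2 scale a b)"
      by (simp add: L_def tens2_apply cofun_dual r.scale_sum_right)
    finally show ?thesis ..
  qed
  with lin show "\<exists>L. linear_on tensor_scale (tensor_sq scale) r UNIV L \<and>
      (\<forall>a b. L (tens2 scale a b) = \<beta> a b)"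
    by blast
next
  assume L: "linear_on tensor_scale (tensor_sq scale) r UNIV L"
    and L': "linear_on tensor_scale (tensor_sq scale) r UNIV L'"
    and eq: "\<forall>a b. L (tens2 scale a b) = L' (tens2 scale a b)"
    and t: "t \<in> tensor_sq scale"
  let ?u = "\<lambda>i j. tensor_scale (t (cofun i) (cofun j)) (tens2 scale i j)"
  have u: "?u i j \<in> tensor_sq scale" for i j
    by (rule tensor_sq_scale[OF tens2_in])
  have "M (\<Sum>i\<in>Basis. \<Sum>j\<in>Basis. ?u i j) =
      (\<Sum>i\<in>Basis. \<Sum>j\<in>Basis. r (t (cofun i) (cofun j)) (M (tens2 scale i j)))"
    if M: "linear_on tensor_scale (tensor_sq scale) r UNIV M" for M
  proof -
    have inner: "M (\<Sum>j\<in>Basis. ?u i j) = (\<Sum>j\<in>Basis. M (?u i j)) \<and>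
        (\<Sum>j\<in>Basis. ?u i j) \<in> tensor_sq scale" for i
      by (rule linear_on_tensor_sum[OF assms(1) M]) (rule u)
    have "M (\<Sum>i\<in>Basis. \<Sum>j\<in>Basis. ?u i j) = (\<Sum>i\<in>Basis. M (\<Sum>j\<in>Basis. ?u i j))"
      using linear_on_tensor_sum[OF assms(1) M, of Basis "\<lambda>i. \<Sum>j\<in>Basis. ?u i j"] inner by blast
    then show ?thesis
      using M inner tens2_in by (simp add: linear_on_def)
  qed
  from this[OF L] this[OF L'] eq show "L t = L' t"
    by (simp add: tensor_sq_expand[OF t, symmetric])
qed

lemma tmap_tens2:
  assumes "linear_on scale UNIV scale UNIV F" "linear_on scale UNIV scale UNIV G"
  shows "tmap scale F G (tens2 scale a b) = tens2 scale (F a) (G b)"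
proof (intro ext)
  fix f g
  have "f \<circ> F \<in> dual_space scale" if "f \<in> dual_space scale"
    by (rule dual_space_compose[OF vector_space_axioms that assms(1)])
  moreover have "g \<circ> G \<in> dual_space scale" if "g \<in> dual_space scale"
    by (rule dual_space_compose[OF vector_space_axioms that assms(2)])
  ultimately show "tmap scale F G (tens2 scale a b) f g = tens2 scale (F a) (G b) f g"
    by (simp add: tmap_def tens2_def form2_def)
qed

lemma tflip_tens2: "tflip (tens2 scale a b) = tens2 scale b a"
  by (auto simp: fun_eq_iff tflip_def tens2_def form2_def)

lemma tflip_id_tens3: "tflip_id (tens3 scale a b c) = tens3 scale b a c"
  by (auto simp: fun_eq_iff tflip_id_def tens3_def form3_def)

text \<open>
  \<open>a \<otimes> u\<close> and \<open>u \<otimes> c\<close> for a tensor \<open>u\<close> of order two appear on the right-hand sides of the next two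
  lemmas; for \<open>u = tens2 scale b c\<close> they are \<open>tens3\<close>.
\<close>

lemma coalgebra_dual:
  assumes "coalgebra scale D" "f \<in> dual_space scale" "g \<in> dual_space scale"
  shows "(\<lambda>a. D a f g) \<in> dual_space scale"
  using assms(1) unfolding dual_space_linear_on[OF vector_space_axioms]
  by (simp add: coalgebra_def linear_on_def tensor_scale_def)

lemma id_tmap_tens2:
  assumes "coalgebra scale D"
  shows "id_tmap scale D (tens2 scale a b) = form3 scale (\<lambda>f g h. f a * D b g h)"
  by (simp add: fun_eq_iff id_tmap_def form3_def tens2_apply coalgebra_dual[OF assms])

lemma tmap_id_tens2:
  assumes "coalgebra scale D"
  shows "tmap_id scale D (tens2 scale a b) = form3 scale (\<lambda>f g h. D a f g * h b)"
  by (simp add: fun_eq_iff tmap_id_def form3_def tens2_apply coalgebra_dual[OF assms])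

lemma tens3_tens2:
  "form3 scale (\<lambda>f g h. f a * tens2 scale b c g h) = tens3 scale a b c"
  "form3 scale (\<lambda>f g h. tens2 scale a b f g * h c) = tens3 scale a b c"
  by (simp_all add: fun_eq_iff tens3_def form3_def tens2_apply)

lemma dual_comult_coalgebra:
  assumes "algebra_on fun_scale (dual_space scale) M"
  shows "coalgebra scale (dual_comult scale M)"
proof -
  have "M f g \<in> dual_space scale" if "f \<in> dual_space scale" "g \<in> dual_space scale" for f g
    using assms that by (simp add: algebra_on_def bilinear_on_def linear_on_def)
  note M = dual_space_add[OF vector_space_axioms this] dual_space_scale[OF vector_space_axioms this]
  have "bilinear_on fun_scale (dual_space scale) fun_scale (dual_space scale) fun_scale (dual_space scale) M"
    using assms by (simp add: algebra_on_def)
  then have "dual_comult scale M a \<in> tensor_sq scale" for a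
    using dual_space_plus[OF vector_space_axioms] dual_space_fun_scale[OF vector_space_axioms]
    by (simp add: tensor_sq_def dual_comult_def form2_def bilinear_on_def linear_on_def fun_eq_iff)
      (simp add: fun_scale_def)
  with M show ?thesis
    by (auto simp: coalgebra_def linear_on_def vector_space_axioms dual_comult_def form2_def
        tensor_scale_def fun_eq_iff)
qed

end

end

theory Submission
  imports Defs
begin

text \<open>
  The proof is a Manin triple argument. The candidate product and bracket on the double
  \<open>A \<oplus> A\<^sup>*\<close> are the ones that make the symmetric pairing
  \<open>\<langle>(a, f), (b, g)\<rangle> = f b + g a\<close> invariant: the bracket satisfies
  \<open>\<langle>[x,y],z\<rangle> = \<langle>x,[y,z]\<rangle>\<close>, right multiplications are self-adjoint,
  \<open>\<langle>xy,z\<rangle> = \<langle>x,zy\<rangle>\<close>, and left multiplication by \<open>x\<close> has adjoint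
  \<open>-(L(x) + R(x))\<close>.
  The pairing is nondegenerate, so each identity in \<open>x, y, z\<close> can be tested against a fourth
  element \<open>w\<close>. By invariance the test becomes a combination of pairings of two products of
  two elements each, and these 4-linear forms have many symmetries in \<open>x, y, z, w\<close>.

  Three facts about the forms carry the theorem. First, left symmetry is a sum of three instances
  of right commutativity (\<open>left_symmetric_iff\<close>), so it imposes nothing new on the whole double.
  Second, the forms vanish as soon as three arguments lie in \<open>A\<close>, or three in \<open>A\<^sup>*\<close>, since both are
  Gel'fand-Dorfman algebras (\<open>forms_three_in_subalgebra\<close>); left symmetry of the two halves
  enters here. By additivity only the arguments with two entries in \<open>A\<close> and two in \<open>A\<^sup>*\<close>
  remain. Third, under the symmetries these fall into five classes (\<open>GD_identities_iff_mixed\<close>):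
  three for right commutativity, one for the Jacobi identity, one for the Gel'fand-Dorfman identity.

  Evaluated on \<open>a, b\<close> in \<open>A\<close> and \<open>f, g\<close> in \<open>A\<^sup>*\<close>, the five classes are the three Novikov bialgebra
  conditions, the Lie bialgebra cocycle condition and the final compatibility condition, each
  paired with \<open>f \<otimes> g\<close> (\<open>rcomm_form_mixed\<close>, \<open>jacobi_form_mixed\<close>, \<open>GD_form_mixed\<close>). What else the
  two sides of the equivalence ask for holds in any case: the actions are bilinear because they are
  transposes of bilinear maps, and the coalgebra axioms are the axioms of \<open>A\<^sup>*\<close> evaluated at a point.
\<close>

section \<open>The identities of a Gel'fand-Dorfman algebra\<close>

definition GD_identities ::
  "('v::ab_group_add \<Rightarrow> 'v \<Rightarrow> 'v) \<Rightarrow> ('v \<Rightarrow> 'v \<Rightarrow> 'v) \<Rightarrow> 'v set \<Rightarrow> bool"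
  where "GD_identities mul brk U \<longleftrightarrow> (\<forall>x\<in>U. \<forall>y\<in>U. \<forall>z\<in>U.
    mul (mul x y) z - mul x (mul y z) = mul (mul y x) z - mul y (mul x z) \<and>
    mul (mul x y) z = mul (mul x z) y \<and>
    brk x (brk y z) + brk y (brk z x) + brk z (brk x y) = 0 \<and>
    brk (mul x y) z - brk (mul x z) y + mul (brk x y) z - mul (brk x z) y - mul x (brk y z) = 0)"

lemma GD_algebra_iff_identities:
  "GD_algebra s U mul brk \<longleftrightarrow> algebra_on s U mul \<and> algebra_on s U brk \<and>
     (\<forall>x\<in>U. brk x x = 0) \<and> GD_identities mul brk U"
  unfolding GD_algebra_def Novikov_algebra_def Lie_algebra_def GD_identities_def
  by (simp only: ball_conj_distrib) blast

lemma fun_scale_plus: "fun_scale c (f + g) = fun_scale c f + fun_scale c g"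
  by (simp add: fun_scale_def fun_eq_iff distrib_left)

lemma GD_identities_image:
  assumes "GD_identities mul brk U"
    and "\<And>x y. x \<in> U \<Longrightarrow> y \<in> U \<Longrightarrow> mul x y \<in> U" "\<And>x y. x \<in> U \<Longrightarrow> y \<in> U \<Longrightarrow> brk x y \<in> U"
    and "\<And>x y. i (x + y) = i x + i y" "\<And>x y. i (x - y) = i x - i y"
    and "\<And>x y. x \<in> U \<Longrightarrow> y \<in> U \<Longrightarrow> mul' (i x) (i y) = i (mul x y)"
    and "\<And>x y. x \<in> U \<Longrightarrow> y \<in> U \<Longrightarrow> brk' (i x) (i y) = i (brk x y)"
  shows "GD_identities mul' brk' (i ` U)"
  unfolding GD_identities_def
proof (intro ballI, elim imageE, hypsubst)
  fix x y z assume xyz: "x \<in> U" "y \<in> U" "z \<in> U"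
  note ids = assms(1)[unfolded GD_identities_def, rule_format, OF xyz]
  note 1 = ids[THEN conjunct1] and 2 = ids[THEN conjunct2, THEN conjunct1]
    and 3 = ids[THEN conjunct2, THEN conjunct2, THEN conjunct1]
    and 4 = ids[THEN conjunct2, THEN conjunct2, THEN conjunct2]
  have zero: "i 0 = 0"
    using assms(5)[of 0 0] by simp
  show "mul' (mul' (i x) (i y)) (i z) - mul' (i x) (mul' (i y) (i z)) =
      mul' (mul' (i y) (i x)) (i z) - mul' (i y) (mul' (i x) (i z)) \<and>
    mul' (mul' (i x) (i y)) (i z) = mul' (mul' (i x) (i z)) (i y) \<and>
    brk' (i x) (brk' (i y) (i z)) + brk' (i y) (brk' (i z) (i x)) + brk' (i z) (brk' (i x) (i y)) = 0 \<and>
    brk' (mul' (i x) (i y)) (i z) - brk' (mul' (i x) (i z)) (i y) + mul' (brk' (i x) (i y)) (i z)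
      - mul' (brk' (i x) (i z)) (i y) - mul' (i x) (brk' (i y) (i z)) = 0"
    by (simp only: assms(2,3,6,7) xyz assms(4,5)[symmetric], intro conjI)
      (rule arg_cong[where f = i], fact 1 | rule arg_cong[where f = i], fact 2 | simp only: 3 4 zero)+
qed

section \<open>Invariant forms\<close>

text \<open>
  The structure that the pairing gives to the double. The two halves are absent from it: all
  symmetries of the forms below are consequences of invariance alone.
\<close>

locale invariant_form =
  fixes V :: "'v::ab_group_add set"
    and B :: "'v \<Rightarrow> 'v \<Rightarrow> 'k::ab_group_add"
    and mul brk :: "'v \<Rightarrow> 'v \<Rightarrow> 'v"
  assumes plus_closed: "x \<in> V \<Longrightarrow> y \<in> V \<Longrightarrow> x + y \<in> V"
    and minus_closed: "x \<in> V \<Longrightarrow> y \<in> V \<Longrightarrow> x - y \<in> V"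
    and mul_closed: "x \<in> V \<Longrightarrow> y \<in> V \<Longrightarrow> mul x y \<in> V"
    and brk_closed: "x \<in> V \<Longrightarrow> y \<in> V \<Longrightarrow> brk x y \<in> V"
    and form_sym: "x \<in> V \<Longrightarrow> y \<in> V \<Longrightarrow> B x y = B y x"
    and form_add: "x \<in> V \<Longrightarrow> y \<in> V \<Longrightarrow> z \<in> V \<Longrightarrow> B (x + y) z = B x z + B y z"
    and nondegenerate: "x \<in> V \<Longrightarrow> (\<And>y. y \<in> V \<Longrightarrow> B x y = 0) \<Longrightarrow> x = 0"
    and mul_add: "x \<in> V \<Longrightarrow> y \<in> V \<Longrightarrow> z \<in> V \<Longrightarrow> mul (x + y) z = mul x z + mul y z"
      "x \<in> V \<Longrightarrow> y \<in> V \<Longrightarrow> z \<in> V \<Longrightarrow> mul x (y + z) = mul x y + mul x z"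
    and brk_add: "x \<in> V \<Longrightarrow> y \<in> V \<Longrightarrow> z \<in> V \<Longrightarrow> brk (x + y) z = brk x z + brk y z"
      "x \<in> V \<Longrightarrow> y \<in> V \<Longrightarrow> z \<in> V \<Longrightarrow> brk x (y + z) = brk x y + brk x z"
    and right_mult_self_adjoint:
      "x \<in> V \<Longrightarrow> y \<in> V \<Longrightarrow> z \<in> V \<Longrightarrow> B (mul x y) z = B x (mul z y)"
    and mul_cyclic:
      "x \<in> V \<Longrightarrow> y \<in> V \<Longrightarrow> z \<in> V \<Longrightarrow> B (mul x y) z + B (mul x z) y + B (mul z x) y = 0"
    and brk_antisym: "x \<in> V \<Longrightarrow> y \<in> V \<Longrightarrow> brk x y = - brk y x"
    and brk_invariant: "x \<in> V \<Longrightarrow> y \<in> V \<Longrightarrow> z \<in> V \<Longrightarrow> B (brk x y) z = B x (brk y z)"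
begin

lemma form_add_right: "x \<in> V \<Longrightarrow> y \<in> V \<Longrightarrow> z \<in> V \<Longrightarrow> B x (y + z) = B x y + B x z"
  by (metis form_sym form_add plus_closed)

lemma form_diff: "x \<in> V \<Longrightarrow> y \<in> V \<Longrightarrow> z \<in> V \<Longrightarrow> B (x - y) z = B x z - B y z"
  by (metis form_add minus_closed diff_add_cancel eq_diff_eq)

lemma zero_closed: "x \<in> V \<Longrightarrow> 0 \<in> V"
  by (metis minus_closed diff_self)

lemma form_zero: "x \<in> V \<Longrightarrow> B 0 x = 0"
  by (metis form_diff diff_self)

lemma form_uminus: "x \<in> V \<Longrightarrow> y \<in> V \<Longrightarrow> B (- x) y = - B x y"
  by (metis diff_0 form_diff form_zero zero_closed)

lemma uminus_closed: "x \<in> V \<Longrightarrow> - x \<in> V"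
  by (metis diff_0 minus_closed zero_closed)

lemma form_uminus_right: "x \<in> V \<Longrightarrow> y \<in> V \<Longrightarrow> B x (- y) = - B x y"
  by (metis form_uminus form_sym uminus_closed)

lemma eq_iff_form: "x \<in> V \<Longrightarrow> y \<in> V \<Longrightarrow> x = y \<longleftrightarrow> (\<forall>w\<in>V. B x w = B y w)"
proof -
  assume *: "x \<in> V" "y \<in> V"
  have "x - y = 0" if "\<forall>w\<in>V. B x w = B y w"
    using * that by (intro nondegenerate) (auto simp: minus_closed form_diff)
  then show ?thesis by auto
qed

text \<open>
  Read as \<open>T(x,y,z) = B(xy,z)\<close>, self-adjointness of right multiplications says
  \<open>T(x,y,z) = T(z,y,x)\<close>, and \<open>mul_cyclic\<close> says that the values of \<open>T\<close> for the three choices of the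
  middle argument add up to zero.
\<close>

lemma left_mult_adjoint:
  "x \<in> V \<Longrightarrow> y \<in> V \<Longrightarrow> z \<in> V \<Longrightarrow> B (mul x y) z = - B y (mul x z) - B y (mul z x)"
  using mul_cyclic[of x y z] form_sym[of y "mul x z"] form_sym[of y "mul z x"]
  by (simp add: mul_closed eq_neg_iff_add_eq_0 algebra_simps)

lemma brk_adjoint: "x \<in> V \<Longrightarrow> y \<in> V \<Longrightarrow> z \<in> V \<Longrightarrow> B (brk x y) z = - B y (brk x z)"
  by (metis brk_antisym brk_invariant brk_closed form_uminus)

lemmas closed = plus_closed minus_closed uminus_closed mul_closed brk_closed

text \<open>
  The identities paired with a fourth element, with invariance applied until every term pairs two
  binary products. The Jacobi expression is \<open>- jacobi_form\<close> after this.
\<close>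

definition rcomm_form where
  "rcomm_form x y z w = B (mul x y) (mul w z) - B (mul x z) (mul w y)"

definition jacobi_form where
  "jacobi_form x y z w =
    B (brk y z) (brk x w) + B (brk z x) (brk y w) + B (brk x y) (brk z w)"

definition GD_form where
  "GD_form x y z w =
    B (mul x y) (brk z w) - B (mul x z) (brk y w) + B (mul w z) (brk x y)
    - B (mul w y) (brk x z) + B (mul x w) (brk y z) + B (mul w x) (brk y z)"

lemma rcomm_iff:
  assumes "x \<in> V" "y \<in> V" "z \<in> V"
  shows "mul (mul x y) z = mul (mul x z) y \<longleftrightarrow> (\<forall>w\<in>V. rcomm_form x y z w = 0)"
  using assms
  by (simp add: eq_iff_form closed rcomm_form_def right_mult_self_adjoint)

text \<open>
  Moving all factors into the shape \<open>B(pq, rs)\<close> leaves six terms, and they group into three values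
  of the right commutativity form. Hence right commutativity everywhere implies left symmetry, and
  conversely left symmetry gives a relation among values of \<open>rcomm_form\<close>.
\<close>

lemma left_symmetric_iff:
  assumes "x \<in> V" "y \<in> V" "z \<in> V"
  shows "mul (mul x y) z - mul x (mul y z) = mul (mul y x) z - mul y (mul x z) \<longleftrightarrow>
    (\<forall>w\<in>V. rcomm_form x y z w + rcomm_form y z x w + rcomm_form x w z y = 0)"
proof -
  have "B (mul (mul x y) z - mul x (mul y z)) w - B (mul (mul y x) z - mul y (mul x z)) w =
      rcomm_form x y z w + rcomm_form y z x w + rcomm_form x w z y" if "w \<in> V" for w
    using that assms form_sym[of "mul x w" "mul y z"] form_sym[of "mul x z" "mul y w"]
    by (simp add: form_diff closed rcomm_form_def right_mult_self_adjoint[of _ z w]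
        left_mult_adjoint[of x "mul y z"] left_mult_adjoint[of y "mul x z"] algebra_simps)
  then show ?thesis
    using assms by (simp add: eq_iff_form closed) (metis eq_iff_diff_eq_0)
qed

lemma jacobi_iff:
  assumes "x \<in> V" "y \<in> V" "z \<in> V"
  shows "brk x (brk y z) + brk y (brk z x) + brk z (brk x y) = 0 \<longleftrightarrow>
    (\<forall>w\<in>V. jacobi_form x y z w = 0)"
proof -
  have "B (brk x (brk y z) + brk y (brk z x) + brk z (brk x y)) w = - jacobi_form x y z w"
    if "w \<in> V" for w
    using that assms
    by (simp add: form_add closed jacobi_form_def brk_adjoint[of x "brk y z"]
        brk_adjoint[of y "brk z x"] brk_adjoint[of z "brk x y"])
  then show ?thesis
    using assms by (simp add: eq_iff_form[OF _ zero_closed] closed form_zero)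
qed

lemma GD_iff:
  assumes "x \<in> V" "y \<in> V" "z \<in> V"
  shows "brk (mul x y) z - brk (mul x z) y + mul (brk x y) z - mul (brk x z) y - mul x (brk y z) = 0
    \<longleftrightarrow> (\<forall>w\<in>V. GD_form x y z w = 0)"
proof -
  have "B (brk (mul x y) z - brk (mul x z) y + mul (brk x y) z - mul (brk x z) y - mul x (brk y z)) w =
      GD_form x y z w" if "w \<in> V" for w
    using that assms
      form_sym[of "mul w z" "brk x y"] form_sym[of "mul w y" "brk x z"]
      form_sym[of "mul x w" "brk y z"] form_sym[of "mul w x" "brk y z"]
    by (simp add: form_add form_diff closed GD_form_def brk_invariant right_mult_self_adjoint[of "brk _ _"]
        left_mult_adjoint[of x "brk y z"])
  then show ?thesis
    using assms by (subst eq_iff_form[OF _ zero_closed[of x]]) (simp_all add: closed form_zero)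
qed

lemma rcomm_form_swap:
  assumes "x \<in> V" "y \<in> V" "z \<in> V" "w \<in> V"
  shows "rcomm_form w y z x = - rcomm_form x y z w" "rcomm_form x z y w = - rcomm_form x y z w"
  using assms form_sym[of "mul x y" "mul w z"] form_sym[of "mul x z" "mul w y"]
  by (simp_all add: rcomm_form_def closed)

lemma jacobi_form_swap:
  assumes "x \<in> V" "y \<in> V" "z \<in> V" "w \<in> V"
  shows "jacobi_form y x z w = - jacobi_form x y z w" "jacobi_form x z y w = - jacobi_form x y z w"
    "jacobi_form x y w z = - jacobi_form x y z w"
  using assms
    brk_antisym[of x y] brk_antisym[of x z] brk_antisym[of x w]
    brk_antisym[of y z] brk_antisym[of y w] brk_antisym[of z w]
    form_sym[of "brk x y" "brk z w"] form_sym[of "brk x z" "brk y w"] form_sym[of "brk x w" "brk y z"]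
  by (simp_all add: jacobi_form_def closed form_uminus form_uminus_right)

lemma GD_form_swap:
  assumes "x \<in> V" "y \<in> V" "z \<in> V" "w \<in> V"
  shows "GD_form x z y w = - GD_form x y z w" "GD_form w y z x = GD_form x y z w"
  using assms
    brk_antisym[of x y] brk_antisym[of x z] brk_antisym[of x w]
    brk_antisym[of y z] brk_antisym[of y w] brk_antisym[of z w]
  by (simp_all add: GD_form_def closed form_uminus form_uminus_right)

text \<open>
  By the swaps, \<open>GD_form x y z w\<close> depends up to sign only on which two arguments take the outer
  places \<open>x\<close> and \<open>w\<close>. The triangle relation adds the values for the three pairs chosen from
  \<open>x, y, z\<close>; it is what relates these six values beyond the symmetries.
\<close>

lemma GD_form_triangle:
  assumes "x \<in> V" "y \<in> V" "z \<in> V" "w \<in> V"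
  shows "GD_form x z w y + GD_form x y w z + GD_form y x w z = 0"
  using assms
    brk_antisym[of x y] brk_antisym[of x z] brk_antisym[of x w]
    brk_antisym[of y z] brk_antisym[of y w] brk_antisym[of z w]
  by (simp add: GD_form_def closed form_uminus form_uminus_right)

lemma forms_add:
  assumes "x \<in> V" "x' \<in> V" "y \<in> V" "z \<in> V" "w \<in> V"
  shows "rcomm_form (x + x') y z w = rcomm_form x y z w + rcomm_form x' y z w"
    "rcomm_form y (x + x') z w = rcomm_form y x z w + rcomm_form y x' z w"
    "rcomm_form y z (x + x') w = rcomm_form y z x w + rcomm_form y z x' w"
    "rcomm_form y z w (x + x') = rcomm_form y z w x + rcomm_form y z w x'"
    "jacobi_form (x + x') y z w = jacobi_form x y z w + jacobi_form x' y z w"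
    "jacobi_form y (x + x') z w = jacobi_form y x z w + jacobi_form y x' z w"
    "jacobi_form y z (x + x') w = jacobi_form y z x w + jacobi_form y z x' w"
    "jacobi_form y z w (x + x') = jacobi_form y z w x + jacobi_form y z w x'"
    "GD_form (x + x') y z w = GD_form x y z w + GD_form x' y z w"
    "GD_form y (x + x') z w = GD_form y x z w + GD_form y x' z w"
    "GD_form y z (x + x') w = GD_form y z x w + GD_form y z x' w"
    "GD_form y z w (x + x') = GD_form y z w x + GD_form y z w x'"
  using assms
  by (simp_all add: rcomm_form_def jacobi_form_def GD_form_def closed mul_add brk_add
      form_add form_add_right)

lemma GD_identities_iff_forms:
  "GD_identities mul brk V \<longleftrightarrow> (\<forall>x\<in>V. \<forall>y\<in>V. \<forall>z\<in>V. \<forall>w\<in>V.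
     rcomm_form x y z w = 0 \<and> jacobi_form x y z w = 0 \<and> GD_form x y z w = 0)"
proof -
  have "GD_identities mul brk V \<longleftrightarrow> (\<forall>x\<in>V. \<forall>y\<in>V. \<forall>z\<in>V.
     (\<forall>w\<in>V. rcomm_form x y z w + rcomm_form y z x w + rcomm_form x w z y = 0) \<and>
     (\<forall>w\<in>V. rcomm_form x y z w = 0) \<and> (\<forall>w\<in>V. jacobi_form x y z w = 0) \<and>
     (\<forall>w\<in>V. GD_form x y z w = 0))"
    by (simp add: GD_identities_def left_symmetric_iff rcomm_iff jacobi_iff GD_iff del: right_minus_eq
       cong: ball_cong)
  also have "\<dots> \<longleftrightarrow> (\<forall>x\<in>V. \<forall>y\<in>V. \<forall>z\<in>V. \<forall>w\<in>V.
     rcomm_form x y z w = 0 \<and> jacobi_form x y z w = 0 \<and> GD_form x y z w = 0)"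
    by (intro iffI ballI conjI) simp_all
  finally show ?thesis .
qed

section \<open>Reduction to mixed arguments\<close>

text \<open>
  With the exceptional argument in the last place this is the definition of the forms, applied to the
  identities of \<open>U\<close>. The symmetries move it to the other places, except that for \<open>rcomm_form\<close> and
  \<open>GD_form\<close> the swaps keep the outer and the inner places apart. For \<open>rcomm_form\<close> the left
  symmetry of \<open>U\<close> makes the passage from an outer to an inner place; for \<open>GD_form\<close> the triangle relation does.
\<close>

lemma forms_three_in_subalgebra:
  assumes U: "U \<subseteq> V" "GD_identities mul brk U" and abc: "a \<in> U" "b \<in> U" "c \<in> U" and h: "h \<in> V"
  shows "rcomm_form h a b c = 0" "rcomm_form a h b c = 0" "rcomm_form a b h c = 0" "rcomm_form a b c h = 0"
    "jacobi_form h a b c = 0" "jacobi_form a h b c = 0" "jacobi_form a b h c = 0" "jacobi_form a b c h = 0"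
    "GD_form h a b c = 0" "GD_form a h b c = 0" "GD_form a b h c = 0" "GD_form a b c h = 0"
proof -
  note V = subsetD[OF U(1)]
  have last: "rcomm_form x y z h = 0" "jacobi_form x y z h = 0" "GD_form x y z h = 0"
    "rcomm_form x y z h + rcomm_form y z x h + rcomm_form x h z y = 0"
    if that: "x \<in> U" "y \<in> U" "z \<in> U" for x y z
  proof -
    have "x \<in> V" "y \<in> V" "z \<in> V"
      using that V by blast+
    note iffs = rcomm_iff[OF this] jacobi_iff[OF this] GD_iff[OF this] left_symmetric_iff[OF this]
    note ids = U(2)[unfolded GD_identities_def, rule_format, OF that]
    show "rcomm_form x y z h = 0" "jacobi_form x y z h = 0" "GD_form x y z h = 0"
      "rcomm_form x y z h + rcomm_form y z x h + rcomm_form x h z y = 0"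
      using ids h unfolding iffs by blast+
  qed
  \<comment> \<open>Of the three terms of left symmetry, two have \<open>h\<close> last, and the third is the wanted one.\<close>
  have second: "rcomm_form x h y z = 0" if "x \<in> U" "y \<in> U" "z \<in> U" for x y z
    using last(1)[of x z y] last(1)[of z y x] last(4)[of x z y] that by simp
  show "rcomm_form a b c h = 0" "jacobi_form a b c h = 0" "GD_form a b c h = 0" "rcomm_form a h b c = 0"
    by (fact last(1-3)[OF abc] second[OF abc])+
  have aV: "a \<in> V" and bV: "b \<in> V" and cV: "c \<in> V"
    using V abc by blast+
  show "rcomm_form h a b c = 0" "rcomm_form a b h c = 0"
    using rcomm_form_swap(1)[OF cV aV bV h] rcomm_form_swap(2)[OF aV h bV cV]
      last(1)[OF abc(3,1,2)] second[OF abc] by simp_all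
  show j3: "jacobi_form a b h c = 0"
    using jacobi_form_swap(3)[OF aV bV cV h] last(2)[OF abc] by simp
  show j2: "jacobi_form a h b c = 0"
    using jacobi_form_swap(2)[OF aV bV h cV] j3 by simp
  show "jacobi_form h a b c = 0"
    using jacobi_form_swap(1)[OF aV h bV cV] j2 by simp
  show "GD_form h a b c = 0"
    using GD_form_swap(2)[OF cV aV bV h] last(3)[OF abc(3,1,2)] by simp
  show G2: "GD_form a h b c = 0"
    using GD_form_triangle[OF aV cV h bV] last(3)[OF abc(1,3,2)] last(3)[OF abc(3,1,2)] by simp
  show "GD_form a b h c = 0"
    using GD_form_swap(1)[OF aV h bV cV] G2 by simp
qed

text \<open>
  Each of the forms is additive in four arguments, so it vanishes if it does on the sixteen patterns
  of arguments from \<open>U1\<close> and \<open>U2\<close>. Ten patterns have three entries in the same half. The other six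
  have two in each half, and the symmetries reduce them to the listed values: for \<open>rcomm_form\<close> the
  inner pair can be in one half, in the other, or mixed; \<open>jacobi_form\<close> is antisymmetric in all arguments;
  for \<open>GD_form\<close> the triangle relation expresses the unmixed patterns by the mixed ones.
\<close>

lemma GD_identities_iff_mixed:
  assumes U: "U1 \<subseteq> V" "U2 \<subseteq> V"
    and decomp: "\<And>x. x \<in> V \<Longrightarrow> \<exists>u\<in>U1. \<exists>v\<in>U2. x = u + v"
    and GD: "GD_identities mul brk U1" "GD_identities mul brk U2"
  shows "GD_identities mul brk V \<longleftrightarrow> (\<forall>a\<in>U1. \<forall>b\<in>U1. \<forall>f\<in>U2. \<forall>g\<in>U2.
     rcomm_form f g b a = 0 \<and> rcomm_form a g f b = 0 \<and> rcomm_form f a b g = 0 \<and>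
     jacobi_form a b f g = 0 \<and> GD_form b a g f = 0)"
    (is "_ \<longleftrightarrow> ?mixed")
proof
  assume "GD_identities mul brk V"
  then show ?mixed
    using U unfolding GD_identities_iff_forms by blast
next
  assume mixed: ?mixed
  note V = subsetD[OF U(1)] subsetD[OF U(2)]
  note three = forms_three_in_subalgebra[OF U(1) GD(1) _ _ _ V(2)]
    forms_three_in_subalgebra[OF U(2) GD(2) _ _ _ V(1)]
    forms_three_in_subalgebra(1,5,9)[OF U(1) GD(1) _ _ _ V(1)]
    forms_three_in_subalgebra(1,5,9)[OF U(2) GD(2) _ _ _ V(2)]
  have rcomm: "rcomm_form f g b a = 0" "rcomm_form a g f b = 0" "rcomm_form f a b g = 0"
    "rcomm_form f b g a = 0" "rcomm_form a f b g = 0" "rcomm_form a b f g = 0"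
    if ab: "a \<in> U1" "b \<in> U1" and fg: "f \<in> U2" "g \<in> U2" for a b f g
  proof -
    have vs: "a \<in> V" "b \<in> V" "f \<in> V" "g \<in> V"
      using ab fg V by blast+
    show m: "rcomm_form f g b a = 0" "rcomm_form a g f b = 0" "rcomm_form f a b g = 0"
      using mixed ab fg by blast+
    have gfba: "rcomm_form g f b a = 0"
      using mixed ab fg by blast
    show "rcomm_form f b g a = 0"
      using rcomm_form_swap(2)[of f g b a] m(1) vs by simp
    show "rcomm_form a f b g = 0"
      using rcomm_form_swap(1)[of g f b a] gfba vs by simp
    show "rcomm_form a b f g = 0"
      using rcomm_form_swap(1)[of g b f a] rcomm_form_swap(2)[of g f b a] gfba vs by simp
  qed
  have jacobi: "jacobi_form a b f g = 0" "jacobi_form a f b g = 0" "jacobi_form a f g b = 0"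
    "jacobi_form f a b g = 0" "jacobi_form f a g b = 0" "jacobi_form f g a b = 0"
    if ab: "a \<in> U1" "b \<in> U1" and fg: "f \<in> U2" "g \<in> U2" for a b f g
  proof -
    have vs: "a \<in> V" "b \<in> V" "f \<in> V" "g \<in> V"
      using ab fg V by blast+
    show "jacobi_form a b f g = 0"
      using mixed ab fg by blast
    with jacobi_form_swap(2)[of a b f g] vs show 2: "jacobi_form a f b g = 0" by simp
    with jacobi_form_swap(3)[of a f b g] vs show 3: "jacobi_form a f g b = 0" by simp
    from 2 jacobi_form_swap(1)[of a f b g] vs show "jacobi_form f a b g = 0" by simp
    from 3 jacobi_form_swap(1)[of a f g b] vs show 5: "jacobi_form f a g b = 0" by simp
    with jacobi_form_swap(2)[of f a g b] vs show "jacobi_form f g a b = 0" by simp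
  qed
  have GD4: "GD_form b a g f = 0" "GD_form b g a f = 0" "GD_form f a g b = 0" "GD_form f g a b = 0"
    if ab: "a \<in> U1" "b \<in> U1" and fg: "f \<in> U2" "g \<in> U2" for a b f g
  proof -
    have vs: "a \<in> V" "b \<in> V" "f \<in> V" "g \<in> V"
      using ab fg V by blast+
    show 1: "GD_form b a g f = 0"
      using mixed ab fg by blast
    with GD_form_swap(1)[of b a g f] vs show 2: "GD_form b g a f = 0" by simp
    from 1 GD_form_swap(2)[of b a g f] vs show "GD_form f a g b = 0" by simp
    from 2 GD_form_swap(2)[of b g a f] vs show "GD_form f g a b = 0" by simp
  qed
  \<comment> \<open>Unmixed outer pairs: the other two terms of the triangle have a mixed outer pair.\<close>
  have GD2: "GD_form f a b g = 0" "GD_form a f g b = 0"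
    if ab: "a \<in> U1" "b \<in> U1" and fg: "f \<in> U2" "g \<in> U2" for a b f g
  proof -
    have vs: "a \<in> V" "b \<in> V" "f \<in> V" "g \<in> V"
      using ab fg V by blast+
    show "GD_form f a b g = 0"
      using GD_form_triangle[of f g a b] GD4 ab fg vs by simp
    show "GD_form a f g b = 0"
      using GD_form_triangle[of a b f g] GD4 ab fg vs by simp
  qed
  have pure: "rcomm_form x y z w = 0" "jacobi_form x y z w = 0" "GD_form x y z w = 0"
    if "x \<in> U1 \<union> U2" "y \<in> U1 \<union> U2" "z \<in> U1 \<union> U2" "w \<in> U1 \<union> U2" for x y z w
    using that by - (elim UnE; (rule three rcomm jacobi GD4 GD2; assumption))+
  have add: "\<Phi> x y z w = 0"
    if "\<And>x x' y z w. x \<in> V \<Longrightarrow> x' \<in> V \<Longrightarrow> y \<in> V \<Longrightarrow> z \<in> V \<Longrightarrow> w \<in> V \<Longrightarrow>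
       \<Phi> (x + x') y z w = \<Phi> x y z w + \<Phi> x' y z w \<and>
       \<Phi> y (x + x') z w = \<Phi> y x z w + \<Phi> y x' z w \<and>
       \<Phi> y z (x + x') w = \<Phi> y z x w + \<Phi> y z x' w \<and>
       \<Phi> y z w (x + x') = \<Phi> y z w x + \<Phi> y z w x'"
     and "\<And>x y z w. x \<in> U1 \<union> U2 \<Longrightarrow> y \<in> U1 \<union> U2 \<Longrightarrow> z \<in> U1 \<union> U2 \<Longrightarrow> w \<in> U1 \<union> U2 \<Longrightarrow> \<Phi> x y z w = 0"
     and xyzw: "x \<in> V" "y \<in> V" "z \<in> V" "w \<in> V"
    for \<Phi> :: "'v \<Rightarrow> 'v \<Rightarrow> 'v \<Rightarrow> 'v \<Rightarrow> 'k" and x y z w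
  proof -
    obtain a f b g c h d k where "x = a + f" "y = b + g" "z = c + h" "w = d + k"
      "a \<in> U1" "b \<in> U1" "c \<in> U1" "d \<in> U1" "f \<in> U2" "g \<in> U2" "h \<in> U2" "k \<in> U2"
      using decomp xyzw by meson
    then show ?thesis
      using that(1,2) V plus_closed by simp
  qed
  show "GD_identities mul brk V"
    unfolding GD_identities_iff_forms
    by (intro ballI conjI; rule add) (simp_all add: forms_add pure)
qed

end

section \<open>Linear and bilinear maps on subspaces\<close>

lemma fun_scale_diff: "fun_scale c (f - g) = fun_scale c f - fun_scale c g"
  by (simp add: fun_scale_def fun_eq_iff right_diff_distrib)

lemma linear_onD:
  assumes "linear_on s U t W F" "vector_space s" "vector_space t" "module.subspace s U" "module.subspace t W"
  shows "x \<in> U \<Longrightarrow> F x \<in> W"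
    and "x \<in> U \<Longrightarrow> y \<in> U \<Longrightarrow> F (x + y) = F x + F y"
    and "x \<in> U \<Longrightarrow> y \<in> U \<Longrightarrow> F (x - y) = F x - F y"
    and "x \<in> U \<Longrightarrow> F (- x) = - F x"
    and "x \<in> U \<Longrightarrow> F (s c x) = t c (F x)"
    and "F 0 = 0"
proof -
  interpret s: vector_space s by fact
  interpret t: vector_space t by fact
  have neg: "- x \<in> U" "F (- x) = - F x" if "x \<in> U" for x
    using assms that s.subspace_neg unfolding linear_on_def
    by (metis s.scale_minus_left s.scale_one t.scale_minus_left t.scale_one)+
  show "x \<in> U \<Longrightarrow> F x \<in> W" "x \<in> U \<Longrightarrow> y \<in> U \<Longrightarrow> F (x + y) = F x + F y"
    "x \<in> U \<Longrightarrow> F (s c x) = t c (F x)"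
    using assms(1) by (simp_all add: linear_on_def)
  show "x \<in> U \<Longrightarrow> F (- x) = - F x" by (rule neg)
  show "x \<in> U \<Longrightarrow> y \<in> U \<Longrightarrow> F (x - y) = F x - F y"
    using assms(1) neg unfolding linear_on_def by (metis diff_conv_add_uminus)
  show "F 0 = 0"
    using assms(1) s.subspace_0[OF assms(4)] unfolding linear_on_def by (metis s.scale_zero_left t.scale_zero_left)
qed

lemma bilinear_onD:
  assumes "bilinear_on s U t V r W F" "vector_space s" "vector_space t" "vector_space r"
    "module.subspace s U" "module.subspace t V" "module.subspace r W"
  shows "x \<in> U \<Longrightarrow> v \<in> V \<Longrightarrow> F x v \<in> W"
    and "x \<in> U \<Longrightarrow> y \<in> U \<Longrightarrow> v \<in> V \<Longrightarrow> F (x + y) v = F x v + F y v"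
    and "x \<in> U \<Longrightarrow> v \<in> V \<Longrightarrow> w \<in> V \<Longrightarrow> F x (v + w) = F x v + F x w"
    and "x \<in> U \<Longrightarrow> v \<in> V \<Longrightarrow> F (s c x) v = r c (F x v)"
    and "x \<in> U \<Longrightarrow> v \<in> V \<Longrightarrow> F x (t c v) = r c (F x v)"
    and "v \<in> V \<Longrightarrow> F 0 v = 0"
    and "x \<in> U \<Longrightarrow> F x 0 = 0"
proof -
  note L = linear_onD[OF _ assms(2,4,5,7), of "\<lambda>x. F x v" for v]
    and R = linear_onD[OF _ assms(3,4,6,7), of "F x" for x]
  have lin: "linear_on s U r W (\<lambda>x. F x v)" if "v \<in> V" for v
    using assms(1) that by (simp add: bilinear_on_def)
  have lin': "linear_on t V r W (F x)" if "x \<in> U" for x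
    using assms(1) that by (simp add: bilinear_on_def)
  show "x \<in> U \<Longrightarrow> v \<in> V \<Longrightarrow> F x v \<in> W"
    "x \<in> U \<Longrightarrow> y \<in> U \<Longrightarrow> v \<in> V \<Longrightarrow> F (x + y) v = F x v + F y v"
    "x \<in> U \<Longrightarrow> v \<in> V \<Longrightarrow> F (s c x) v = r c (F x v)" "v \<in> V \<Longrightarrow> F 0 v = 0"
    by (rule L[OF lin]; assumption)+
  show "x \<in> U \<Longrightarrow> v \<in> V \<Longrightarrow> w \<in> V \<Longrightarrow> F x (v + w) = F x v + F x w"
    "x \<in> U \<Longrightarrow> v \<in> V \<Longrightarrow> F x (t c v) = r c (F x v)" "x \<in> U \<Longrightarrow> F x 0 = 0"
    by (rule R[OF lin']; assumption)+
qed

section \<open>Transposed actions between an algebra and its dual\<close>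

locale GD_algebra_and_dual = finite_dimensional_vector_space scale Basis
  for scale :: "'k::field \<Rightarrow> 'a::ab_group_add \<Rightarrow> 'a" and Basis :: "'a set" +
  fixes m br :: "'a \<Rightarrow> 'a \<Rightarrow> 'a" and mD brD :: "('a \<Rightarrow> 'k) \<Rightarrow> ('a \<Rightarrow> 'k) \<Rightarrow> ('a \<Rightarrow> 'k)"
  assumes GD: "GD_algebra scale UNIV m br"
    and GD_dual: "GD_algebra fun_scale (dual_space scale) mD brD"
begin

abbreviation D where "D \<equiv> dual_space scale"

lemma subspace_dual: "module.subspace fun_scale D"
proof -
  interpret fs: vector_space "fun_scale :: 'k \<Rightarrow> ('a \<Rightarrow> 'k) \<Rightarrow> 'a \<Rightarrow> 'k"
    by (rule vector_space_fun_scale)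
  have "fun_scale 0 (cofun undefined) \<in> D"
    by (rule dual_space_fun_scale[OF vector_space_axioms cofun_dual])
  then have "0 \<in> D"
    by (simp add: fun_scale_def zero_fun_def)
  then show ?thesis
    unfolding fs.subspace_def
    using dual_space_plus[OF vector_space_axioms] dual_space_fun_scale[OF vector_space_axioms] by blast
qed

lemma vector_space_field: "vector_space ((*) :: 'k \<Rightarrow> 'k \<Rightarrow> 'k)"
  by (auto intro: vector_space.intro simp: algebra_simps)

lemma subspace_field: "module.subspace ((*) :: 'k \<Rightarrow> 'k \<Rightarrow> 'k) UNIV"
  by (rule module.subspace_UNIV) (use vector_space_field in \<open>simp add: vector_space_def module_def\<close>)

lemma dual_eval:
  assumes "f \<in> D"
  shows "f (x + y) = f x + f y" "f (x - y) = f x - f y" "f (- x) = - f x" "f (scale c x) = c * f x" "f 0 = 0"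
  using linear_onD(2-)[OF assms[unfolded dual_space_linear_on[OF vector_space_axioms]]
      vector_space_axioms vector_space_field subspace_UNIV subspace_field] by simp_all

lemma D_closed:
  "0 \<in> D" "f \<in> D \<Longrightarrow> g \<in> D \<Longrightarrow> f + g \<in> D" "f \<in> D \<Longrightarrow> g \<in> D \<Longrightarrow> f - g \<in> D" "f \<in> D \<Longrightarrow> - f \<in> D"
  "f \<in> D \<Longrightarrow> fun_scale c f \<in> D"
proof -
  interpret fs: vector_space "fun_scale :: 'k \<Rightarrow> ('a \<Rightarrow> 'k) \<Rightarrow> 'a \<Rightarrow> 'k"
    by (rule vector_space_fun_scale)
  show "0 \<in> D" "f \<in> D \<Longrightarrow> g \<in> D \<Longrightarrow> f + g \<in> D" "f \<in> D \<Longrightarrow> g \<in> D \<Longrightarrow> f - g \<in> D" "f \<in> D \<Longrightarrow> - f \<in> D"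
    "f \<in> D \<Longrightarrow> fun_scale c f \<in> D"
    by (fact fs.subspace_0[OF subspace_dual] fs.subspace_add[OF subspace_dual]
        fs.subspace_diff[OF subspace_dual] fs.subspace_neg[OF subspace_dual]
        fs.subspace_scale[OF subspace_dual])+
qed

lemma algebra_parts:
  "algebra_on scale UNIV m" "algebra_on scale UNIV br" "algebra_on fun_scale D mD" "algebra_on fun_scale D brD"
  "GD_identities m br UNIV" "GD_identities mD brD D" "br x x = 0" "f \<in> D \<Longrightarrow> brD f f = 0"
  using GD GD_dual unfolding GD_algebra_iff_identities by blast+

lemma algebra_linear:
  "linear_on scale UNIV scale UNIV (m x)" "linear_on scale UNIV scale UNIV (\<lambda>x. m x y)"
  "linear_on scale UNIV scale UNIV (br x)" "linear_on scale UNIV scale UNIV (\<lambda>x. br x y)"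
  "f \<in> D \<Longrightarrow> linear_on fun_scale D fun_scale D (mD f)" "f \<in> D \<Longrightarrow> linear_on fun_scale D fun_scale D (\<lambda>g. mD g f)"
  "f \<in> D \<Longrightarrow> linear_on fun_scale D fun_scale D (brD f)" "f \<in> D \<Longrightarrow> linear_on fun_scale D fun_scale D (\<lambda>g. brD g f)"
  using algebra_parts(1-4) by (simp_all add: algebra_on_def bilinear_on_def)

lemmas linear_A = linear_onD(2-)[OF _ vector_space_axioms vector_space_axioms subspace_UNIV subspace_UNIV, simplified]
lemmas linear_D = linear_onD[OF _ vector_space_fun_scale vector_space_fun_scale subspace_dual subspace_dual]

lemmas mult_simps =
  linear_A[OF algebra_linear(1)] linear_A[OF algebra_linear(2)]
  linear_A[OF algebra_linear(3)] linear_A[OF algebra_linear(4)]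
  linear_D[OF algebra_linear(5)] linear_D[OF algebra_linear(6)]
  linear_D[OF algebra_linear(7)] linear_D[OF algebra_linear(8)]

lemma br_antisym: "br x y = - br y x"
proof -
  have "br (x + y) (x + y) = br x x + br y x + (br x y + br y y)"
    by (simp only: linear_A(1)[OF algebra_linear(3)] linear_A(1)[OF algebra_linear(4)])
  then have "br y x + br x y = 0"
    by (simp only: algebra_parts(7) add_0_left add_0_right)
  from minus_unique[OF this] show ?thesis ..
qed

lemma brD_antisym:
  assumes "f \<in> D" "g \<in> D"
  shows "brD f g = - brD g f"
proof -
  have "brD (f + g) (f + g) = brD f f + brD g f + (brD f g + brD g g)"
    using assms by (simp only: linear_D(2)[OF algebra_linear(7)] linear_D(2)[OF algebra_linear(8)] D_closed(2))
  then have "brD g f + brD f g = 0"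
    using assms by (simp only: algebra_parts(8) D_closed(2) add_0_left add_0_right)
  from minus_unique[OF this] show ?thesis ..
qed

lemma comp_in_D:
  assumes "f \<in> D"
  shows "f \<circ> m x \<in> D" "f \<circ> R_op m x \<in> D" "f \<circ> star m x \<in> D" "f \<circ> br x \<in> D"
  using assms unfolding dual_space_linear_on[OF vector_space_axioms]
  by (auto simp: linear_on_def mult_simps R_op_def star_def algebra_simps)

lemma comp_zero: "0 \<circ> F = 0"
  by (simp add: fun_eq_iff)

lemma comp_mult_zero:
  assumes "f \<in> D"
  shows "f \<circ> m 0 = 0" "f \<circ> star m 0 = 0" "f \<circ> R_op m 0 = 0" "f \<circ> br 0 = 0"
  using assms by (simp_all add: fun_eq_iff star_def R_op_def mult_simps dual_eval)

text \<open>
  The action \<open>L\<^sub>\<star>\<^sup>*\<close> mixes left and right multiplications, and in the compatibility condition for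
  \<open>[\<cdot>,\<cdot>]\<close> and \<open>\<circ>\<close> some of its right halves cancel; this splits them off.
\<close>

lemma comp_star: "f \<in> D \<Longrightarrow> f \<circ> star m x = (f \<circ> m x) + (f \<circ> R_op m x)"
  by (simp add: fun_eq_iff star_def R_op_def dual_eval)

lemma dual_rep_comp: "dual_rep \<phi> x f = - (f \<circ> \<phi> x)"
  by (simp add: dual_rep_def fun_eq_iff)

lemma R_op_eq: "R_op mul x = (\<lambda>y. mul y x)"
  by (simp add: fun_eq_iff R_op_def)

lemma star_mD_linear: "f \<in> D \<Longrightarrow> linear_on fun_scale D fun_scale D (star mD f)"
  unfolding linear_on_def star_def
  by (intro conjI ballI allI; simp only: mult_simps D_closed fun_scale_plus add_ac)

lemma bidual_rep_eval:
  assumes "f \<in> D" "h \<in> D"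
  shows "h (bidual_rep scale (star mD) f a) = - mD f h a - mD h f a"
    "h (bidual_rep scale (R_op mD) f a) = - mD h f a"
    "h (bidual_rep scale brD f a) = - brD f h a"
proof -
  show "h (bidual_rep scale (star mD) f a) = - mD f h a - mD h f a"
    unfolding bidual_rep_pairing[of "star mD", OF star_mD_linear[OF assms(1)] assms(2)] by (simp add: star_def)
  show "h (bidual_rep scale (R_op mD) f a) = - mD h f a"
    by (subst bidual_rep_pairing) (simp_all only: R_op_eq algebra_linear assms)
  show "h (bidual_rep scale brD f a) = - brD f h a"
    by (rule bidual_rep_pairing[of brD, OF algebra_linear(7)[OF assms(1)] assms(2)])
qed

text \<open>
  Elements of \<open>A\<close> produced by \<open>bidual_rep\<close> are known only through their pairings, so equations
  between them are proved by separating points.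
\<close>

lemma eqI_dual: "(\<And>h. h \<in> D \<Longrightarrow> h x = h y) \<Longrightarrow> x = y"
  using dual_separates by blast

lemma bidual_rep_bilinear:
  "bilinear_on fun_scale D scale UNIV scale UNIV (bidual_rep scale (star mD))"
  "bilinear_on fun_scale D scale UNIV scale UNIV (bidual_rep scale (R_op mD))"
  "bilinear_on fun_scale D scale UNIV scale UNIV (bidual_rep scale brD)"
  "bilinear_on fun_scale D scale UNIV scale UNIV (- bidual_rep scale (R_op mD))"
  unfolding bilinear_on_def linear_on_def
  by (intro conjI ballI allI UNIV_I eqI_dual;
      simp add: bidual_rep_eval dual_eval mult_simps D_closed;
      simp add: fun_scale_def right_diff_distrib)+

lemma dual_rep_bilinear:
  "bilinear_on scale UNIV fun_scale D fun_scale D (dual_rep (star m))"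
  "bilinear_on scale UNIV fun_scale D fun_scale D (dual_rep (R_op m))"
  "bilinear_on scale UNIV fun_scale D fun_scale D (dual_rep br)"
  "bilinear_on scale UNIV fun_scale D fun_scale D (- dual_rep (R_op m))"
proof -
  have "dual_rep (star m) a f \<in> D" "dual_rep (R_op m) a f \<in> D" "dual_rep br a f \<in> D" if "f \<in> D" for a f
    using that by (simp_all add: dual_rep_comp comp_in_D D_closed)
  then show "bilinear_on scale UNIV fun_scale D fun_scale D (dual_rep (star m))"
    "bilinear_on scale UNIV fun_scale D fun_scale D (dual_rep (R_op m))"
    "bilinear_on scale UNIV fun_scale D fun_scale D (dual_rep br)"
    "bilinear_on scale UNIV fun_scale D fun_scale D (- dual_rep (R_op m))"
    unfolding bilinear_on_def linear_on_def
    by (simp_all add: D_closed) (simp_all add: dual_rep_def fun_eq_iff fun_scale_def star_def R_op_def dual_eval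
       mult_simps distrib_left right_diff_distrib)
qed

lemmas rep_simps =
  bilinear_onD[OF bidual_rep_bilinear(1) vector_space_fun_scale vector_space_axioms vector_space_axioms
    subspace_dual subspace_UNIV subspace_UNIV]
  bilinear_onD[OF bidual_rep_bilinear(2) vector_space_fun_scale vector_space_axioms vector_space_axioms
    subspace_dual subspace_UNIV subspace_UNIV]
  bilinear_onD[OF bidual_rep_bilinear(3) vector_space_fun_scale vector_space_axioms vector_space_axioms
    subspace_dual subspace_UNIV subspace_UNIV]
  bilinear_onD[OF dual_rep_bilinear(1) vector_space_axioms vector_space_fun_scale vector_space_fun_scale
    subspace_UNIV subspace_dual subspace_dual]
  bilinear_onD[OF dual_rep_bilinear(2) vector_space_axioms vector_space_fun_scale vector_space_fun_scale
    subspace_UNIV subspace_dual subspace_dual]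
  bilinear_onD[OF dual_rep_bilinear(3) vector_space_axioms vector_space_fun_scale vector_space_fun_scale
    subspace_UNIV subspace_dual subspace_dual]

section \<open>The double and its invariant pairing\<close>

abbreviation mprod where "mprod \<equiv> matched_product m mD (dual_rep (star m)) (- dual_rep (R_op m))
  (bidual_rep scale (star mD)) (- bidual_rep scale (R_op mD))"

abbreviation mbrk where "mbrk \<equiv> matched_bracket br brD (dual_rep br) (bidual_rep scale brD)"

definition pairing :: "'a \<times> ('a \<Rightarrow> 'k) \<Rightarrow> 'a \<times> ('a \<Rightarrow> 'k) \<Rightarrow> 'k"
  where "pairing x y = snd x (fst y) + snd y (fst x)"

lemma mprod_apply:
  "mprod (a, f) (b, g) =
    (m a b + bidual_rep scale (star mD) f b - bidual_rep scale (R_op mD) g a,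
     mD f g - (g \<circ> star m a) + (f \<circ> R_op m b))"
  by (simp add: matched_product_def dual_rep_comp)

lemma mbrk_apply:
  "mbrk (a, f) (b, g) =
    (br a b + bidual_rep scale brD f b - bidual_rep scale brD g a,
     brD f g - (g \<circ> br a) + (f \<circ> br b))"
  by (simp add: matched_bracket_def dual_rep_comp)

text \<open>
  Invariance can be read off from the next two formulas: the first is unchanged when \<open>(a, f)\<close> and
  \<open>(c, h)\<close> trade places, and the second changes sign when any two of \<open>(a, f)\<close>, \<open>(b, g)\<close>, \<open>(c, h)\<close> do.
\<close>

lemma pairing_mprod:
  assumes "f \<in> D" "g \<in> D" "h \<in> D"
  shows "pairing (mprod (a, f) (b, g)) (c, h) =
    mD f g c - g (m a c) - g (m c a) + f (m c b) + h (m a b) - mD f h b - mD h f b + mD h g a"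
  using assms by (simp add: mprod_apply pairing_def dual_eval bidual_rep_eval star_def R_op_def)

lemma pairing_mbrk:
  assumes "f \<in> D" "g \<in> D" "h \<in> D"
  shows "pairing (mbrk (a, f) (b, g)) (c, h) =
    brD f g c - g (br a c) + f (br b c) + h (br a b) - brD f h b + brD g h a"
  using assms by (simp add: mbrk_apply pairing_def dual_eval bidual_rep_eval)

lemma pairing_commute: "pairing x y = pairing y x"
  by (simp add: pairing_def add.commute)

lemma invariant_form_pairing: "invariant_form (UNIV \<times> D) pairing mprod mbrk"
proof
  fix x y z :: "'a \<times> ('a \<Rightarrow> 'k)"
  assume x: "x \<in> UNIV \<times> D" 
  obtain a f where xaf: "x = (a, f)" "f \<in> D" using x by auto
  show "x = 0" if *: "\<And>y. y \<in> UNIV \<times> D \<Longrightarrow> pairing x y = 0"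
  proof -
    have "g a = g 0" if "g \<in> D" for g
      using *[of "(0, g)"] that xaf by (simp add: pairing_def dual_eval)
    then have "a = 0" by (rule eqI_dual)
    moreover have "f b = 0" for b
      using *[of "(b, 0)"] D_closed(1) xaf by (simp add: pairing_def)
    ultimately show ?thesis
      using xaf by (simp add: zero_prod_def fun_eq_iff)
  qed
  assume y: "y \<in> UNIV \<times> D"
  obtain b g where ybg: "y = (b, g)" "g \<in> D" using y by auto
  show "x + y \<in> UNIV \<times> D" "x - y \<in> UNIV \<times> D" "mprod x y \<in> UNIV \<times> D" "mbrk x y \<in> UNIV \<times> D"
    using xaf ybg by (simp_all add: mprod_apply mbrk_apply D_closed comp_in_D mult_simps)
  show "pairing x y = pairing y x"
    by (rule pairing_commute)
  show "mbrk x y = - mbrk y x"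
    using xaf ybg br_antisym[of a b] brD_antisym[of f g] by (simp add: mbrk_apply)
  assume z: "z \<in> UNIV \<times> D"
  obtain c h where zch: "z = (c, h)" "h \<in> D" using z by auto
  show "pairing (x + y) z = pairing x z + pairing y z"
    using xaf ybg zch by (simp add: pairing_def dual_eval)
  show "mprod (x + y) z = mprod x z + mprod y z" "mprod x (y + z) = mprod x y + mprod x z"
    "mbrk (x + y) z = mbrk x z + mbrk y z" "mbrk x (y + z) = mbrk x y + mbrk x z"
    using xaf ybg zch
    by (simp_all add: matched_product_def matched_bracket_def rep_simps mult_simps)
  show "pairing (mprod x y) z = pairing x (mprod z y)"
    by (subst pairing_commute[of x]) (use xaf ybg zch in \<open>simp add: pairing_mprod\<close>)
  show "pairing (mprod x y) z + pairing (mprod x z) y + pairing (mprod z x) y = 0"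
    using xaf ybg zch by (simp add: pairing_mprod)
  show "pairing (mbrk x y) z = pairing x (mbrk y z)"
    by (subst pairing_commute[of x])
      (use xaf ybg zch brD_antisym[of f h] brD_antisym[of f g] brD_antisym[of g h]
        br_antisym[of a b] br_antisym[of a c] br_antisym[of b c]
       in \<open>simp add: pairing_mbrk dual_eval\<close>)
qed

sublocale double: invariant_form "UNIV \<times> D" pairing mprod mbrk
  by (rule invariant_form_pairing)

text \<open>
  Everything in a matched pair apart from the identities of the double is automatic for the
  transposed actions.
\<close>

lemma matched_pair_iff_identities:
  "matched_pair_GD scale UNIV m br fun_scale D mD brD
      (dual_rep (star m)) (- dual_rep (R_op m)) (dual_rep br)
      (bidual_rep scale (star mD)) (- bidual_rep scale (R_op mD)) (bidual_rep scale brD)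
    \<longleftrightarrow> GD_identities mprod mbrk (UNIV \<times> D)"
proof -
  interpret P: vector_space_prod scale "fun_scale :: 'k \<Rightarrow> ('a \<Rightarrow> 'k) \<Rightarrow> 'a \<Rightarrow> 'k"
    by (intro vector_space_prod.intro vector_space_pair.intro vector_space_axioms vector_space_fun_scale)
  have "bilinear_on P.scale (UNIV \<times> D) P.scale (UNIV \<times> D) P.scale (UNIV \<times> D) mprod"
    "bilinear_on P.scale (UNIV \<times> D) P.scale (UNIV \<times> D) P.scale (UNIV \<times> D) mbrk"
    unfolding bilinear_on_def linear_on_def
    using double.mul_closed double.brk_closed double.mul_add double.brk_add
    by (auto simp: P.scale_def matched_product_def matched_bracket_def rep_simps mult_simps D_closed
        scale_right_distrib scale_right_diff_distrib fun_scale_plus fun_scale_diff)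
  then have "algebra_on P.scale (UNIV \<times> D) mprod" "algebra_on P.scale (UNIV \<times> D) mbrk"
    using P.p.vector_space_axioms P.subspace_Times[OF subspace_UNIV subspace_dual]
    by (simp_all add: algebra_on_def)
  moreover have "mbrk x x = 0" if "x \<in> UNIV \<times> D" for x
    using that by (auto simp: mbrk_apply algebra_parts(7,8) zero_prod_def)
  ultimately show ?thesis
    using GD GD_dual bidual_rep_bilinear dual_rep_bilinear
    unfolding matched_pair_GD_def GD_algebra_iff_identities[of _ "UNIV \<times> D"] by blast
qed

section \<open>The compatibility conditions as mixed forms\<close>

text \<open>
  A product \<open>xy\<close> with \<open>x\<close> in one half and \<open>y\<close> in the other has components in both halves, so each
  of the next forms expands into values like \<open>\<phi>(u)\<close> with \<open>u = L\<^sub>\<star>\<^sup>*(f) b\<close>; transposing the action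
  turns them into products in \<open>A\<^sup>*\<close> evaluated at an element of \<open>A\<close>.
\<close>

lemma rcomm_form_mixed:
  assumes "f \<in> D" "g \<in> D"
  shows "double.rcomm_form (0, f) (0, g) (b, 0) (a, 0) =
      mD f g (m a b) - (mD (f \<circ> R_op m b) g a + mD f (g \<circ> star m a) b + mD (g \<circ> star m a) f b)"
    "double.rcomm_form (a, 0) (0, g) (0, f) (b, 0) =
      (mD (f \<circ> star m a) g b - mD (g \<circ> star m a) f b) -
      (mD (f \<circ> star m b) g a - mD (g \<circ> star m b) f a)"
    "double.rcomm_form (0, f) (a, 0) (b, 0) (0, g) =
      (mD g (f \<circ> R_op m b) a + mD (f \<circ> R_op m b) g a - mD f (g \<circ> R_op m b) a - mD (g \<circ> R_op m b) f a) -
      (mD g (f \<circ> R_op m a) b + mD (f \<circ> R_op m a) g b - mD f (g \<circ> R_op m a) b - mD (g \<circ> R_op m a) f b)"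
  using assms
  by (simp_all add: double.rcomm_form_def mprod_apply pairing_def rep_simps mult_simps
      bidual_rep_eval dual_eval D_closed comp_in_D comp_zero comp_mult_zero del: o_apply)

lemma jacobi_form_mixed:
  assumes "f \<in> D" "g \<in> D"
  shows "double.jacobi_form (a, 0) (b, 0) (0, f) (0, g) =
      brD f g (br a b) - (brD (f \<circ> br a) g b + brD f (g \<circ> br a) b
       - (brD (f \<circ> br b) g a + brD f (g \<circ> br b) a))"
  using assms brD_antisym[OF assms(1) comp_in_D(4)[OF assms(2)]] brD_antisym[OF assms(2) comp_in_D(4)[OF assms(1)]]
  by (simp add: double.jacobi_form_def mbrk_apply pairing_def rep_simps mult_simps
      bidual_rep_eval dual_eval D_closed comp_in_D comp_zero comp_mult_zero del: o_apply)

lemma GD_form_mixed: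
  assumes "f \<in> D" "g \<in> D"
  shows "double.GD_form (b, 0) (a, 0) (0, g) (0, f) =
      (brD (f \<circ> R_op m a) g b + brD (f \<circ> m b) g a + brD f (g \<circ> star m b) a
       + (mD (f \<circ> br a) g b + mD f (g \<circ> br a) b) - (mD f (g \<circ> br b) a + mD (g \<circ> br b) f a))
      - (brD f g (m b a) + mD f g (br a b))"
  using assms brD_antisym[OF assms(2) assms(1)] br_antisym[of b a]
   brD_antisym[OF assms(2) comp_in_D(1)[OF assms(1)]]  brD_antisym[OF assms(2) comp_in_D(2)[OF assms(1)]]
   brD_antisym[OF assms(1) comp_in_D(1)[OF assms(2)]]  brD_antisym[OF assms(1) comp_in_D(2)[OF assms(2)]]
  by (simp add: double.GD_form_def mprod_apply mbrk_apply pairing_def rep_simps mult_simps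
      bidual_rep_eval dual_eval D_closed comp_in_D comp_zero comp_mult_zero comp_star del: o_apply)

text \<open>
  The three conditions of a Novikov bialgebra, the cocycle condition of a Lie bialgebra and the last
  condition of a Gel'fand-Dorfman bialgebra, each paired with \<open>f \<otimes> g\<close>.
\<close>

definition compatible :: "'a \<Rightarrow> 'a \<Rightarrow> ('a \<Rightarrow> 'k) \<Rightarrow> ('a \<Rightarrow> 'k) \<Rightarrow> bool"
  where "compatible a b f g \<longleftrightarrow>
    mD f g (m a b) = mD (f \<circ> R_op m b) g a + mD f (g \<circ> star m a) b + mD (g \<circ> star m a) f b \<and>
    mD (f \<circ> star m a) g b - mD (g \<circ> star m a) f b = mD (f \<circ> star m b) g a - mD (g \<circ> star m b) f a \<and>
    mD f (g \<circ> R_op m a) b + mD (g \<circ> R_op m a) f b - (mD (f \<circ> R_op m a) g b + mD g (f \<circ> R_op m a) b) =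
    mD f (g \<circ> R_op m b) a + mD (g \<circ> R_op m b) f a - (mD (f \<circ> R_op m b) g a + mD g (f \<circ> R_op m b) a) \<and>
    brD f g (br a b) =
      brD (f \<circ> br a) g b + brD f (g \<circ> br a) b - (brD (f \<circ> br b) g a + brD f (g \<circ> br b) a) \<and>
    brD f g (m b a) + mD f g (br a b) =
      brD (f \<circ> R_op m a) g b + brD (f \<circ> m b) g a + brD f (g \<circ> star m b) a
       + (mD (f \<circ> br a) g b + mD f (g \<circ> br a) b) - (mD f (g \<circ> br b) a + mD (g \<circ> br b) f a)"

lemma double_identities_iff_compatible:
  "GD_identities mprod mbrk (UNIV \<times> D) \<longleftrightarrow> (\<forall>a b. \<forall>f\<in>D. \<forall>g\<in>D. compatible a b f g)"
proof -
  let ?A = "range (\<lambda>a. (a, 0 :: 'a \<Rightarrow> 'k))" and ?B = "(\<lambda>f. (0 :: 'a, f)) ` D"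
  have "GD_identities mprod mbrk ?A"
    by (rule GD_identities_image[OF algebra_parts(5)])
      (simp_all add: mprod_apply mbrk_apply rep_simps mult_simps D_closed comp_zero comp_mult_zero zero_prod_def)
  moreover have "GD_identities mprod mbrk ?B"
    by (rule GD_identities_image[OF algebra_parts(6)])
      (simp_all add: mprod_apply mbrk_apply rep_simps mult_simps D_closed zero_prod_def comp_mult_zero)
  moreover have "?A \<subseteq> UNIV \<times> D" "?B \<subseteq> UNIV \<times> D"
    using D_closed(1) by auto
  moreover have "\<exists>u\<in>?A. \<exists>v\<in>?B. x = u + v" if "x \<in> UNIV \<times> D" for x
    using that by (auto intro!: bexI)
  ultimately have "GD_identities mprod mbrk (UNIV \<times> D) \<longleftrightarrow> (\<forall>a\<in>?A. \<forall>b\<in>?A. \<forall>f\<in>?B. \<forall>g\<in>?B.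
     double.rcomm_form f g b a = 0 \<and> double.rcomm_form a g f b = 0 \<and> double.rcomm_form f a b g = 0 \<and>
     double.jacobi_form a b f g = 0 \<and> double.GD_form b a g f = 0)"
    by (intro double.GD_identities_iff_mixed)
  also have "\<dots> \<longleftrightarrow> (\<forall>a b. \<forall>f\<in>D. \<forall>g\<in>D. compatible a b f g)"
    unfolding ball_simps compatible_def
    by (auto simp: rcomm_form_mixed jacobi_form_mixed GD_form_mixed algebra_simps)
  finally show ?thesis .
qed

section \<open>The dual coalgebra and the bialgebra conditions\<close>

lemma comult_eval: "f \<in> D \<Longrightarrow> g \<in> D \<Longrightarrow> dual_comult scale M a f g = M f g a"
  by (simp add: dual_comult_def form2_def)

text \<open>
  Paired with \<open>f \<otimes> g \<otimes> h\<close>, an iterated comultiplication of \<open>a\<close> is an iterated product of \<open>f, g, h\<close>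
  evaluated at \<open>a\<close>, so each coalgebra axiom is one of the identities of \<open>A\<^sup>*\<close>, up to antisymmetry of
  the bracket.
\<close>

lemma GD_coalgebra_dual: "GD_coalgebra scale (dual_comult scale mD) (dual_comult scale brD)"
proof -
  have co: "id_tmap scale (dual_comult scale M) (dual_comult scale N a) =
        form3 scale (\<lambda>f g h. N f (M g h) a)"
      "tmap_id scale (dual_comult scale M) (dual_comult scale N a) =
        form3 scale (\<lambda>f g h. N (M f g) h a)"
      "id_tmap scale (dual_comult scale M) (tflip (dual_comult scale N a)) =
        form3 scale (\<lambda>f g h. N (M g h) f a)"
    if "\<And>f g. f \<in> D \<Longrightarrow> g \<in> D \<Longrightarrow> M f g \<in> D" for M N a
    using that by (auto simp: fun_eq_iff id_tmap_def tmap_id_def form3_def comult_eval tflip_def)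
  have closed: "mD f g \<in> D" "brD f g \<in> D" if "f \<in> D" "g \<in> D" for f g
    using that by (simp_all only: mult_simps)
  note co = co[OF closed(1)] co[OF closed(2)]
  have eqI: "t = u" if "\<And>f g h. f \<in> D \<Longrightarrow> g \<in> D \<Longrightarrow> h \<in> D \<Longrightarrow> t f g h = u f g h"
    "\<And>f g h. \<not> (f \<in> D \<and> g \<in> D \<and> h \<in> D) \<Longrightarrow> t f g h = 0 \<and> u f g h = 0" for t u :: "('a, 'k) tensor3"
  proof (intro ext)
    show "t f g h = u f g h" for f g h
      using that(1)[of f g h] that(2)[of f g h] by (cases "f \<in> D \<and> g \<in> D \<and> h \<in> D") auto
  qed
  have ids: "mD (mD f g) h - mD f (mD g h) = mD (mD g f) h - mD g (mD f h)"
    "mD (mD f g) h = mD (mD f h) g"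
    "brD f (brD g h) + brD g (brD h f) + brD h (brD f g) = 0"
    "brD (mD f g) h - brD (mD f h) g + mD (brD f g) h - mD (brD f h) g - mD f (brD g h) = 0"
    if "f \<in> D" "g \<in> D" "h \<in> D" for f g h
    using algebra_parts(6)[unfolded GD_identities_def, rule_format, OF that] by blast+
  have lsym: "mD f (mD g h) a - mD g (mD f h) a = mD (mD f g) h a - mD (mD g f) h a"
    if "f \<in> D" "g \<in> D" "h \<in> D" for f g h a
    using fun_cong[OF ids(1)[OF that], of a] by (simp add: algebra_simps)
  have rcomm: "mD (mD f h) g a = mD (mD f g) h a"
    if "f \<in> D" "g \<in> D" "h \<in> D" for f g h a
    using fun_cong[OF ids(2)[OF that], of a] by simp
  have jac: "brD f (brD g h) a - brD g (brD f h) a = brD (brD f g) h a"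
    if "f \<in> D" "g \<in> D" "h \<in> D" for f g h a
  proof -
    have "brD g (brD h f) = - brD g (brD f h)"
      by (simp only: brD_antisym[OF that(3,1)] mult_simps closed that)
    moreover have "brD h (brD f g) = - brD (brD f g) h"
      by (rule brD_antisym[OF that(3) closed(2)[OF that(1,2)]])
    ultimately show ?thesis
      using fun_cong[OF ids(3)[OF that], of a] by simp
  qed
  have gd: "mD f (brD g h) a - brD g (mD f h) a + mD (brD f h) g a = brD (mD f g) h a + mD (brD f g) h a"
    if "f \<in> D" "g \<in> D" "h \<in> D" for f g h a
    using fun_cong[OF ids(4)[OF that], of a] brD_antisym[OF that(2) closed(1)[OF that(1,3)]]
    by (simp add: algebra_simps)
  show ?thesis
    unfolding GD_coalgebra_def Novikov_coalgebra_def Lie_coalgebra_def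
  proof (intro conjI allI)
    show "coalgebra scale (dual_comult scale mD)" "coalgebra scale (dual_comult scale brD)"
      by (rule dual_comult_coalgebra, rule algebra_parts)+
    show "dual_comult scale brD a = - tflip (dual_comult scale brD a)" for a
    proof (intro ext)
      show "dual_comult scale brD a f g = (- tflip (dual_comult scale brD a)) f g" for f g
        using brD_antisym[of f g] by (auto simp: dual_comult_def form2_def tflip_def)
    qed
  next
    fix a
    let ?\<Delta> = "dual_comult scale mD" and ?\<delta> = "dual_comult scale brD"
    show "id_tmap scale ?\<Delta> (?\<Delta> a) - tflip_id (id_tmap scale ?\<Delta> (?\<Delta> a)) =
        tmap_id scale ?\<Delta> (?\<Delta> a) - tflip_id (tmap_id scale ?\<Delta> (?\<Delta> a))"
      by (rule eqI) (auto simp: co tflip_id_def form3_def lsym)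
    show "tflip_id (id_tmap scale ?\<Delta> (tflip (?\<Delta> a))) = tmap_id scale ?\<Delta> (?\<Delta> a)"
      by (rule eqI) (auto simp: co tflip_id_def form3_def rcomm)
    show "id_tmap scale ?\<delta> (?\<delta> a) - tflip_id (id_tmap scale ?\<delta> (?\<delta> a)) = tmap_id scale ?\<delta> (?\<delta> a)"
      by (rule eqI) (auto simp: co tflip_id_def form3_def jac)
    show "id_tmap scale ?\<delta> (?\<Delta> a) - tflip_id (id_tmap scale ?\<Delta> (?\<delta> a)) +
        tflip_id (id_tmap scale ?\<delta> (tflip (?\<Delta> a))) =
        tmap_id scale ?\<Delta> (?\<delta> a) + tmap_id scale ?\<delta> (?\<Delta> a)"
      by (rule eqI) (auto simp: co tflip_id_def form3_def gd)
  qed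
qed

text \<open>
  Tensors are functions on a full function type; the hypothesis is their normalisation off the dual
  space, and under it equality can be tested on simple tensors \<open>f \<otimes> g\<close> of functionals.
\<close>

lemma tensor2_eq_iff:
  fixes t u :: "('a, 'k) tensor2"
  assumes "\<And>f g. \<not> (f \<in> D \<and> g \<in> D) \<Longrightarrow> t f g = 0 \<and> u f g = 0"
  shows "t = u \<longleftrightarrow> (\<forall>f\<in>D. \<forall>g\<in>D. t f g = u f g)"
proof
  assume eq: "\<forall>f\<in>D. \<forall>g\<in>D. t f g = u f g"
  show "t = u"
  proof (intro ext)
    show "t f g = u f g" for f g
      using eq assms[of f g] by (cases "f \<in> D \<and> g \<in> D") auto
  qed
qed simp

lemma GD_bialgebra_iff_compatible:
  "GD_bialgebra scale m br (dual_comult scale mD) (dual_comult scale brD) \<longleftrightarrow>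
    (\<forall>a b. \<forall>f\<in>D. \<forall>g\<in>D. compatible a b f g)"
proof -
  let ?\<Delta> = "dual_comult scale mD" and ?\<delta> = "dual_comult scale brD"
  have 1: "?\<Delta> (m a b) = tmap scale (R_op m b) id (?\<Delta> a) + tmap scale id (star m a) (?\<Delta> b + tflip (?\<Delta> b))
    \<longleftrightarrow> (\<forall>f\<in>D. \<forall>g\<in>D. mD f g (m a b) = mD (f \<circ> R_op m b) g a + mD f (g \<circ> star m a) b + mD (g \<circ> star m a) f b)"
    for a b
    by (subst tensor2_eq_iff) (auto simp: tmap_def tflip_def form2_def dual_comult_def comp_in_D add.assoc)
  have 2: "tmap scale (star m a) id (?\<Delta> b) - tmap scale id (star m a) (tflip (?\<Delta> b)) =
      tmap scale (star m b) id (?\<Delta> a) - tmap scale id (star m b) (tflip (?\<Delta> a))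
    \<longleftrightarrow> (\<forall>f\<in>D. \<forall>g\<in>D. mD (f \<circ> star m a) g b - mD (g \<circ> star m a) f b =
        mD (f \<circ> star m b) g a - mD (g \<circ> star m b) f a)"
    for a b
    by (subst tensor2_eq_iff) (auto simp: tmap_def tflip_def form2_def dual_comult_def comp_in_D)
  have 3: "tmap scale id (R_op m a) (?\<Delta> b + tflip (?\<Delta> b)) - tmap scale (R_op m a) id (?\<Delta> b + tflip (?\<Delta> b)) =
      tmap scale id (R_op m b) (?\<Delta> a + tflip (?\<Delta> a)) - tmap scale (R_op m b) id (?\<Delta> a + tflip (?\<Delta> a))
    \<longleftrightarrow> (\<forall>f\<in>D. \<forall>g\<in>D.
       mD f (g \<circ> R_op m a) b + mD (g \<circ> R_op m a) f b - (mD (f \<circ> R_op m a) g b + mD g (f \<circ> R_op m a) b) =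
       mD f (g \<circ> R_op m b) a + mD (g \<circ> R_op m b) f a - (mD (f \<circ> R_op m b) g a + mD g (f \<circ> R_op m b) a))"
    for a b
    by (subst tensor2_eq_iff) (auto simp: tmap_def tflip_def form2_def dual_comult_def comp_in_D)
  have 4: "?\<delta> (br a b) = tensor_act scale br a (?\<delta> b) - tensor_act scale br b (?\<delta> a)
    \<longleftrightarrow> (\<forall>f\<in>D. \<forall>g\<in>D. brD f g (br a b) =
      brD (f \<circ> br a) g b + brD f (g \<circ> br a) b - (brD (f \<circ> br b) g a + brD f (g \<circ> br b) a))"
    for a b
    by (subst tensor2_eq_iff) (auto simp: tensor_act_def tmap_def form2_def dual_comult_def comp_in_D)
  have 5: "?\<delta> (m b a) + ?\<Delta> (br a b) =
       tmap scale (R_op m a) id (?\<delta> b) + tmap scale (m b) id (?\<delta> a) + tmap scale id (star m b) (?\<delta> a)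
       + tensor_act scale br a (?\<Delta> b) - tmap scale id (br b) (?\<Delta> a + tflip (?\<Delta> a))
    \<longleftrightarrow> (\<forall>f\<in>D. \<forall>g\<in>D. brD f g (m b a) + mD f g (br a b) =
      brD (f \<circ> R_op m a) g b + brD (f \<circ> m b) g a + brD f (g \<circ> star m b) a
       + (mD (f \<circ> br a) g b + mD f (g \<circ> br a) b) - (mD f (g \<circ> br b) a + mD (g \<circ> br b) f a))"
    for a b
    by (subst tensor2_eq_iff) (auto simp: tensor_act_def tmap_def tflip_def form2_def dual_comult_def comp_in_D)
  have "Novikov_algebra scale UNIV m" "Lie_algebra scale UNIV br"
    "Novikov_coalgebra scale ?\<Delta>" "Lie_coalgebra scale ?\<delta>"
    using GD GD_coalgebra_dual by (simp_all add: GD_algebra_def GD_coalgebra_def)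
  then show ?thesis
    unfolding GD_bialgebra_def Novikov_bialgebra_def Lie_bialgebra_def 1 2 3 4 5 compatible_def
    using GD GD_coalgebra_dual by blast
qed

end

theorem theorem4p9:
  fixes scale :: "'k::field_char_0 \<Rightarrow> 'a::ab_group_add \<Rightarrow> 'a"
    and Basis :: "'a set"
    and m br :: "'a \<Rightarrow> 'a \<Rightarrow> 'a"
    and mD brD :: "('a \<Rightarrow> 'k) \<Rightarrow> ('a \<Rightarrow> 'k) \<Rightarrow> ('a \<Rightarrow> 'k)"
    and \<Delta> \<delta> :: "'a \<Rightarrow> ('a, 'k) tensor2"
  assumes "finite_dimensional_vector_space scale Basis"
    and "GD_algebra scale UNIV m br"
    and "GD_algebra fun_scale (dual_space scale) mD brD"
    and "\<Delta> = dual_comult scale mD"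
    and "\<delta> = dual_comult scale brD"
  shows "matched_pair_GD scale UNIV m br fun_scale (dual_space scale) mD brD
      (dual_rep (star m)) (- dual_rep (R_op m)) (dual_rep br)
      (bidual_rep scale (star mD)) (- bidual_rep scale (R_op mD)) (bidual_rep scale brD)
    \<longleftrightarrow> GD_bialgebra scale m br \<Delta> \<delta>"
proof -
  interpret GD_algebra_and_dual scale Basis m br mD brD
    by (intro GD_algebra_and_dual.intro GD_algebra_and_dual_axioms.intro assms)
  show ?thesis
    unfolding assms(4,5) matched_pair_iff_identities double_identities_iff_compatible
      GD_bialgebra_iff_compatible ..
qed

end
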